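(* The fundamental group $B$ of the Bolza surface is contained strictly between two principal congruence subgroups as follows: $$\mathcal{Q}_B^1(2)/\{\pm1\}\ \subsetneq\ B\ \subsetneq\ \mathcal{Q}_B^1(\sqrt2)/\{\pm1\}.$$
   Context: $K=\mathbb{Q}(\sqrt2)$, $O_K=\mathbb{Z}[\sqrt2]$. $D_B$ is the quaternion algebra over $K$ with basis $1,i,j,ij$ and relations $i^2=-3$, $j^2=\sqrt2$, $ji=-ij$. Put $\alpha=\frac12(1+i)$, $\beta=\frac16\bigl(3+(1+2\sqrt2)i-2ij\bigr)$, and let $\mathcal{Q}_B=O_K[\alpha,\beta]$ be the $O_K$-subalgebra of $D_B$ they generate (a maximal order). $\mathcal{Q}_B^1$ is the group of elements of reduced norm $1$ in $\mathcal{Q}_B$, and for an ideal $I$ of $O_K$, $\mathcal{Q}_B^1(I)$ is the kernel of $\mathcal{Q}_B^1\to(\mathcal{Q}_B/I\mathcal{Q}_B)^\times$; $\mathcal{Q}_B^1(2)$ and $\mathcal{Q}_B^1(\sqrt2)$ are the cases $I=2O_K$, $I=\sqrt2O_K$ (both contain $-1$). The Bolza group $B$ (the Fuchsian group, i.e. fundamental group, of the Bolza surface) is the normal subgroup of $\mathcal{Q}_B^1/\{\pm1\}$ generated, as a normal subgroup, by the image of $(\alpha\beta)^2(\alpha^2\beta^2)^2$ (equivalently, of $(\alpha\beta)^2(\beta\alpha)^{-2}$). *)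

theory Defs
  imports "HOL-Algebra.Algebra" Complex_Main
begin

typedef qsqrt2 = "{x :: real. \<exists>a b. x = of_rat a + of_rat b * sqrt 2}"
  morphisms real_of_K Abs_K
  by blast

setup_lifting type_definition_qsqrt2

lemma sqrt_2_irrational: "sqrt 2 \<notin> \<rat>"
proof
  assume "sqrt 2 \<in> \<rat>"
  then obtain m n :: nat where n: "n \<noteq> 0" and q: "\<bar>sqrt 2\<bar> = real m / real n" and co: "coprime m n"
    by (rule Rats_abs_nat_div_natE)
  have "sqrt 2 * real n = real m" using q n by simp
  then have "(sqrt 2 * real n)\<^sup>2 = (real m)\<^sup>2" by simp
  then have "real (2 * n\<^sup>2) = real (m\<^sup>2)" by (simp add: power_mult_distrib)
  then have e: "2 * n\<^sup>2 = m\<^sup>2" by (simp only: of_nat_eq_iff)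
  then have "even (m\<^sup>2)" by (metis dvd_triv_left)
  then have m: "even m" by simp
  then obtain k where "m = 2 * k" by blast
  with e have "n\<^sup>2 = 2 * k\<^sup>2" by (simp add: power2_eq_square)
  then have "even (n\<^sup>2)" by (metis dvd_triv_left)
  then have "even n" by simp
  with m have "is_unit (2 :: nat)" using co coprime_common_divisor by blast
  then show False by simp
qed

lemma inverse_qsqrt2_rep:
  "\<exists>a' b'. inverse (of_rat a + of_rat b * sqrt 2 :: real) = of_rat a' + of_rat b' * sqrt 2"
proof (cases "a - b = 0 \<and> b = 0 \<or> a ^ 2 - 2 * b ^ 2 = 0")
  case True
  then have n: "a ^ 2 = 2 * b ^ 2" by auto
  have "b = 0"
  proof (rule ccontr)
    assume b: "b \<noteq> 0"
    have "(of_rat a :: real) ^ 2 = 2 * (of_rat b) ^ 2"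
      using arg_cong[OF n, of "of_rat :: rat \<Rightarrow> real"] by (simp add: of_rat_power of_rat_mult)
    then have "(of_rat (a / b) :: real) ^ 2 = 2"
      using b by (simp add: of_rat_divide power_divide)
    then have "(of_rat \<bar>a / b\<bar> :: real) ^ 2 = 2"
      by (cases "a / b \<ge> 0") (simp_all add: abs_if of_rat_minus)
    then have "sqrt 2 = of_rat \<bar>a / b\<bar>"
      by (intro real_sqrt_unique) auto
    then have "sqrt 2 \<in> \<rat>" by simp
    moreover have "sqrt 2 \<notin> \<rat>"
      by (rule sqrt_2_irrational)
    ultimately show False by blast
  qed
  with n show ?thesis by (intro exI[of _ 0]) auto
next
  case False
  define n where "n = a ^ 2 - 2 * b ^ 2"
  have n: "(of_rat n :: real) \<noteq> 0" using False by (simp add: n_def)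
  have e: "(of_rat n :: real) = (of_rat a + of_rat b * sqrt 2) * (of_rat a - of_rat b * sqrt 2)"
    by (simp add: n_def of_rat_diff of_rat_mult of_rat_power algebra_simps power2_eq_square)
  have "of_rat a + of_rat b * sqrt 2 \<noteq> (0::real)" using n e by auto
  then have "inverse (of_rat a + of_rat b * sqrt 2) = (of_rat a - of_rat b * sqrt 2) / (of_rat n :: real)"
    using n unfolding e by (simp add: field_simps)
  also have "\<dots> = of_rat (a / n) + of_rat (- b / n) * sqrt 2"
    by (simp add: of_rat_divide of_rat_minus diff_divide_distrib)
  finally show ?thesis by blast
qed

instantiation qsqrt2 :: field
begin

lift_definition zero_qsqrt2 :: qsqrt2 is 0
  by (intro exI[of _ 0]) simp

lift_definition one_qsqrt2 :: qsqrt2 is 1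
  by (intro exI[of _ 1] exI[of _ 0]) simp

lift_definition plus_qsqrt2 :: "qsqrt2 \<Rightarrow> qsqrt2 \<Rightarrow> qsqrt2" is "(+)"
proof clarify
  fix a b c d
  show "\<exists>e f. of_rat a + of_rat b * sqrt 2 + (of_rat c + of_rat d * sqrt 2)
      = of_rat e + of_rat f * sqrt 2"
    by (intro exI[of _ "a + c"] exI[of _ "b + d"]) (simp add: of_rat_add algebra_simps)
qed

lift_definition uminus_qsqrt2 :: "qsqrt2 \<Rightarrow> qsqrt2" is uminus
proof clarify
  fix a b
  show "\<exists>e f. - (of_rat a + of_rat b * sqrt 2) = of_rat e + of_rat f * sqrt 2"
    by (intro exI[of _ "- a"] exI[of _ "- b"]) (simp add: of_rat_minus)
qed

lift_definition minus_qsqrt2 :: "qsqrt2 \<Rightarrow> qsqrt2 \<Rightarrow> qsqrt2" is "(-)"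
proof clarify
  fix a b c d
  show "\<exists>e f. of_rat a + of_rat b * sqrt 2 - (of_rat c + of_rat d * sqrt 2)
      = of_rat e + of_rat f * sqrt 2"
    by (intro exI[of _ "a - c"] exI[of _ "b - d"]) (simp add: of_rat_diff algebra_simps)
qed

lift_definition times_qsqrt2 :: "qsqrt2 \<Rightarrow> qsqrt2 \<Rightarrow> qsqrt2" is "(*)"
proof clarify
  fix a b c d
  show "\<exists>e f. (of_rat a + of_rat b * sqrt 2) * (of_rat c + of_rat d * sqrt 2)
      = of_rat e + of_rat f * sqrt 2"
    by (intro exI[of _ "a * c + 2 * b * d"] exI[of _ "a * d + b * c"])
      (simp add: of_rat_add of_rat_mult algebra_simps)
qed

lift_definition inverse_qsqrt2 :: "qsqrt2 \<Rightarrow> qsqrt2" is inverse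
  using inverse_qsqrt2_rep by blast

definition divide_qsqrt2 :: "qsqrt2 \<Rightarrow> qsqrt2 \<Rightarrow> qsqrt2"
  where "divide_qsqrt2 x y = x * inverse y"

instance
  by standard (unfold divide_qsqrt2_def, (transfer, simp add: algebra_simps)+)

end

instance qsqrt2 :: field_char_0
proof
  have "real_of_K (of_nat n) = of_nat n" for n
    by (induction n) (simp_all add: zero_qsqrt2.rep_eq plus_qsqrt2.rep_eq one_qsqrt2.rep_eq)
  then show "inj (of_nat :: nat \<Rightarrow> qsqrt2)"
    by (metis injI of_nat_eq_iff)
qed

lift_definition sqrt2 :: qsqrt2 is "sqrt 2"
  by (intro exI[of _ 0] exI[of _ 1]) simp

lemma sqrt2_squared: "sqrt2 * sqrt2 = 2"
proof -
  have "sqrt2 * sqrt2 = 1 + 1" by transfer simp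
  then show ?thesis by simp
qed

lemma sqrt2_sqrt2: "sqrt2 * (sqrt2 * z) = 2 * z"
  by (metis mult.assoc sqrt2_squared)

definition O_K :: "qsqrt2 set"
  where "O_K = {of_int m + of_int n * sqrt2 | m n. True}"

text \<open>\<open>Quat a b c d\<close> is the quaternion \<open>a + b i + c j + d ij\<close>.\<close>

datatype D_B = Quat (co1: qsqrt2) (coi: qsqrt2) (coj: qsqrt2) (coij: qsqrt2)

lemma D_B_eq_iff:
  "x = y \<longleftrightarrow> co1 x = co1 y \<and> coi x = coi y \<and> coj x = coj y \<and> coij x = coij y"
  by (cases x; cases y) simp

text \<open>The product is the one forced by \<open>i\<^sup>2 = -3\<close>, \<open>j\<^sup>2 = sqrt 2\<close>, \<open>ji = -ij\<close>; in particular
  \<open>(ij)\<^sup>2 = 3 sqrt 2\<close>. The relations are restated below as \<open>i_squared\<close>, \<open>j_squared\<close>, \<open>j_times_i\<close>.\<close>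

instantiation D_B :: ring_1
begin

definition "0 = Quat 0 0 0 0"
definition "1 = Quat 1 0 0 0"
definition "x + y = Quat (co1 x + co1 y) (coi x + coi y) (coj x + coj y) (coij x + coij y)"
definition "x - y = Quat (co1 x - co1 y) (coi x - coi y) (coj x - coj y) (coij x - coij y)"
definition "- x = Quat (- co1 x) (- coi x) (- coj x) (- coij x)"
definition "x * y = Quat
  (co1 x * co1 y - 3 * coi x * coi y + sqrt2 * coj x * coj y + 3 * sqrt2 * coij x * coij y)
  (co1 x * coi y + coi x * co1 y - sqrt2 * coj x * coij y + sqrt2 * coij x * coj y)
  (co1 x * coj y + coj x * co1 y - 3 * coi x * coij y + 3 * coij x * coi y)
  (co1 x * coij y + coij x * co1 y + coi x * coj y - coj x * coi y)"

lemmas D_B_ops = zero_D_B_def one_D_B_def plus_D_B_def minus_D_B_def uminus_D_B_def times_D_B_def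

instance
  by standard (simp_all add: D_B_ops algebra_simps)

end

definition scale :: "qsqrt2 \<Rightarrow> D_B \<Rightarrow> D_B"  (infixr "*\<^sub>K" 75)
  where "c *\<^sub>K x = Quat (c * co1 x) (c * coi x) (c * coj x) (c * coij x)"

definition qi :: D_B where "qi = Quat 0 1 0 0"
definition qj :: D_B where "qj = Quat 0 0 1 0"

lemma i_squared: "qi * qi = - 3"
proof -
  have "qi * qi = - (1 + 1 + 1)" by (simp add: qi_def D_B_ops)
  then show ?thesis by simp
qed

lemma j_squared: "qj * qj = sqrt2 *\<^sub>K 1"
  by (simp add: qj_def D_B_ops scale_def)

lemma j_times_i: "qj * qi = - (qi * qj)"
  by (simp add: qi_def qj_def D_B_ops)

lemma D_B_basis: "Quat a b c d = a *\<^sub>K 1 + b *\<^sub>K qi + c *\<^sub>K qj + d *\<^sub>K (qi * qj)"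
  by (simp add: qi_def qj_def D_B_ops scale_def)

lemma scale_mult: "(a *\<^sub>K x) * (b *\<^sub>K y) = (a * b) *\<^sub>K (x * y)"
  by (simp add: D_B_ops scale_def algebra_simps)

interpretation D_B: vector_space scale
  by standard (simp_all add: D_B_ops scale_def algebra_simps)

definition qconj :: "D_B \<Rightarrow> D_B"
  where "qconj x = Quat (co1 x) (- coi x) (- coj x) (- coij x)"

definition nrd :: "D_B \<Rightarrow> qsqrt2"
  where "nrd x = (co1 x)\<^sup>2 + 3 * (coi x)\<^sup>2 - sqrt2 * (coj x)\<^sup>2 - 3 * sqrt2 * (coij x)\<^sup>2"

lemma nrd_conj: "x * qconj x = nrd x *\<^sub>K 1" "qconj x * x = nrd x *\<^sub>K 1"
  by (simp_all add: D_B_ops scale_def qconj_def nrd_def algebra_simps power2_eq_square)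

lemma nrd_mult: "nrd (x * y) = nrd x * nrd y"
  by (simp add: D_B_ops nrd_def algebra_simps power2_eq_square sqrt2_sqrt2 sqrt2_squared)

definition \<alpha> :: D_B where "\<alpha> = (1 / 2) *\<^sub>K (1 + qi)"

definition \<beta> :: D_B
  where "\<beta> = (1 / 6) *\<^sub>K (3 + (1 + 2 * sqrt2) *\<^sub>K qi - 2 * (qi * qj))"

definition OK_subalgebra :: "D_B set \<Rightarrow> bool"
  where "OK_subalgebra S \<longleftrightarrow> 1 \<in> S \<and> (\<forall>x\<in>S. \<forall>y\<in>S. x + y \<in> S \<and> x * y \<in> S)
    \<and> (\<forall>a\<in>O_K. \<forall>x\<in>S. a *\<^sub>K x \<in> S)"

definition Q_B :: "D_B set"
  where "Q_B = OK_subalgebra hull {\<alpha>, \<beta>}"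

definition Q_B_ring :: "D_B ring"
  where "Q_B_ring = \<lparr>carrier = Q_B, monoid.mult = (*), one = 1, ring.zero = 0, ring.add = (+)\<rparr>"

definition Q_B1 :: "D_B monoid"
  where "Q_B1 = \<lparr>carrier = {x \<in> Q_B. nrd x = 1}, monoid.mult = (*), one = 1\<rparr>"

definition ideal_times_Q_B :: "qsqrt2 set \<Rightarrow> D_B set"
  where "ideal_times_Q_B I =
    {\<Sum>k<n. a k *\<^sub>K x k | (n::nat) a x. \<forall>k<n. a k \<in> I \<and> x k \<in> Q_B}"

definition Q_B1_cong :: "qsqrt2 set \<Rightarrow> D_B set"
  where "Q_B1_cong I = kernel Q_B1 (units_of (Q_B_ring Quot ideal_times_Q_B I))
    (\<lambda>x. ideal_times_Q_B I +>\<^bsub>Q_B_ring\<^esub> x)"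

definition principal_OK :: "qsqrt2 \<Rightarrow> qsqrt2 set"
  where "principal_OK c = {c * a | a. a \<in> O_K}"

definition PQ_B1 :: "D_B set monoid"
  where "PQ_B1 = Q_B1 Mod {1, - 1}"

definition proj :: "D_B \<Rightarrow> D_B set"
  where "proj x = {1, - 1} #>\<^bsub>Q_B1\<^esub> x"

text \<open>For a subgroup \<open>H\<close> of \<open>Q_B1\<close> containing \<open>-1\<close>, the quotient \<open>H / {1, -1}\<close> is the
  image \<open>proj ` H\<close> inside \<open>PQ_B1\<close>. The hull below is the normal closure.\<close>

definition Bolza_group :: "D_B set set"
  where "Bolza_group =
    (\<lambda>N. N \<lhd> PQ_B1) hull {proj ((\<alpha> * \<beta>)\<^sup>2 * (\<alpha>\<^sup>2 * \<beta>\<^sup>2)\<^sup>2)}"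

lemma O_K_closed:
  assumes "x \<in> O_K" "y \<in> O_K"
  shows "x + y \<in> O_K" "x - y \<in> O_K" "x * y \<in> O_K"
proof -
  obtain a b c d where x: "x = of_int a + of_int b * sqrt2" and y: "y = of_int c + of_int d * sqrt2"
    using assms by (auto simp: O_K_def)
  have "x + y = of_int (a + c) + of_int (b + d) * sqrt2"
    by (simp add: x y algebra_simps)
  then show "x + y \<in> O_K" unfolding O_K_def by blast
  have "x - y = of_int (a - c) + of_int (b - d) * sqrt2"
    by (simp add: x y algebra_simps)
  then show "x - y \<in> O_K" unfolding O_K_def by blast
  have "x * y = of_int (a * c + 2 * b * d) + of_int (a * d + b * c) * sqrt2"
    by (simp add: x y algebra_simps sqrt2_sqrt2)
  then show "x * y \<in> O_K" unfolding O_K_def by blast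
qed

lemma of_int_O_K: "of_int m \<in> O_K"
  unfolding O_K_def by (rule CollectI, rule exI[of _ m], rule exI[of _ 0]) simp

lemma one_O_K: "1 \<in> O_K" and zero_O_K: "0 \<in> O_K" and minus_one_O_K: "- 1 \<in> O_K"
  using of_int_O_K[of 1] of_int_O_K[of 0] of_int_O_K[of "-1"] by simp_all

lemma sqrt2_O_K: "sqrt2 \<in> O_K"
  unfolding O_K_def by (rule CollectI, rule exI[of _ 0], rule exI[of _ 1]) simp

lemma OK_subalgebra_Q_B: "OK_subalgebra Q_B"
  unfolding Q_B_def
proof (rule hull_in)
  fix T assume T: "Ball T OK_subalgebra"
  show "OK_subalgebra (\<Inter> T)"
    using T unfolding OK_subalgebra_def by (simp add: Ball_def)
qed

lemma one_Q_B: "1 \<in> Q_B"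
  using OK_subalgebra_Q_B by (simp only: OK_subalgebra_def)

lemma scale_Q_B: "a \<in> O_K \<Longrightarrow> x \<in> Q_B \<Longrightarrow> a *\<^sub>K x \<in> Q_B"
  using OK_subalgebra_Q_B by (simp only: OK_subalgebra_def)

lemma Q_B_closed:
  assumes x: "x \<in> Q_B" and y: "y \<in> Q_B"
  shows "x + y \<in> Q_B" "x * y \<in> Q_B" "- x \<in> Q_B" "x - y \<in> Q_B"
proof -
  have add: "u + v \<in> Q_B" if "u \<in> Q_B" "v \<in> Q_B" for u v
    using OK_subalgebra_Q_B that by (simp only: OK_subalgebra_def)
  have neg: "- u \<in> Q_B" if "u \<in> Q_B" for u
    using scale_Q_B[OF minus_one_O_K that] by simp
  show "x + y \<in> Q_B" using x y by (rule add)
  show "x * y \<in> Q_B" using OK_subalgebra_Q_B x y by (simp only: OK_subalgebra_def)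
  show "- x \<in> Q_B" using x by (rule neg)
  show "x - y \<in> Q_B" using add[OF x neg[OF y]] by simp
qed

lemma zero_Q_B: "0 \<in> Q_B"
  using Q_B_closed(4)[OF one_Q_B one_Q_B] by simp

lemma alpha_Q_B: "\<alpha> \<in> Q_B" and beta_Q_B: "\<beta> \<in> Q_B"
  using hull_subset[of "{\<alpha>, \<beta>}" OK_subalgebra] by (auto simp: Q_B_def)

lemma alpha_coords: "\<alpha> = Quat (1/2) (1/2) 0 0"
  by (simp add: \<alpha>_def scale_def D_B_ops qi_def)

lemma beta_coords: "\<beta> = Quat (1/2) ((1 + 2 * sqrt2) / 6) 0 (- 1/3)"
proof -
  have "(1 + 1 :: D_B) = Quat 2 0 0 0" "(1 + 1 + 1 :: D_B) = Quat 3 0 0 0"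
    by (simp_all add: one_D_B_def plus_D_B_def)
  moreover have "(3 :: D_B) = 1 + 1 + 1" "(2 :: D_B) = 1 + 1" by simp_all
  ultimately have n: "(3 :: D_B) = Quat 3 0 0 0" "(2 :: D_B) = Quat 2 0 0 0"
    by (simp_all only:)
  show ?thesis
    unfolding \<beta>_def n
    by (simp add: scale_def plus_D_B_def minus_D_B_def times_D_B_def qi_def qj_def)
qed

lemma nrd_alpha: "nrd \<alpha> = 1"
  by (simp add: nrd_def alpha_coords power2_eq_square)

lemma nrd_beta: "nrd \<beta> = 1"
  by (simp add: nrd_def beta_coords power2_eq_square field_simps sqrt2_squared)

lemma alpha_cubed: "\<alpha> ^ 3 = - 1"
  by (simp add: power3_eq_cube alpha_coords D_B_ops)

lemma beta_cubed: "\<beta> ^ 3 = - 1"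
  by (simp add: power3_eq_cube beta_coords D_B_ops field_simps sqrt2_squared sqrt2_sqrt2)

lemma Q_B_ring: "ring Q_B_ring"
proof (rule ringI)
  show "abelian_group Q_B_ring"
  proof (rule abelian_groupI)
    fix x assume "x \<in> carrier Q_B_ring"
    then show "\<exists>y\<in>carrier Q_B_ring. y \<oplus>\<^bsub>Q_B_ring\<^esub> x = \<zero>\<^bsub>Q_B_ring\<^esub>"
      by (intro bexI[of _ "- x"]) (auto simp: Q_B_ring_def Q_B_closed)
  qed (auto simp: Q_B_ring_def Q_B_closed zero_Q_B algebra_simps)
  show "Group.monoid Q_B_ring"
    by (rule Group.monoidI) (auto simp: Q_B_ring_def Q_B_closed one_Q_B mult.assoc)
qed (auto simp: Q_B_ring_def algebra_simps)

lemma qconj_Q_B: "x \<in> Q_B \<Longrightarrow> qconj x \<in> Q_B"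
proof -
  have "OK_subalgebra {x \<in> Q_B. qconj x \<in> Q_B}"
    unfolding OK_subalgebra_def
  proof (intro conjI ballI)
    show "1 \<in> {x \<in> Q_B. qconj x \<in> Q_B}"
      using one_Q_B by (simp add: qconj_def one_D_B_def)
    show "a *\<^sub>K x \<in> {x \<in> Q_B. qconj x \<in> Q_B}"
      if "a \<in> O_K" "x \<in> {x \<in> Q_B. qconj x \<in> Q_B}" for a x
    proof -
      have "qconj (a *\<^sub>K x) = a *\<^sub>K qconj x" by (simp add: qconj_def scale_def)
      with that show ?thesis by (simp add: scale_Q_B)
    qed
    fix x y assume xy: "x \<in> {x \<in> Q_B. qconj x \<in> Q_B}" "y \<in> {x \<in> Q_B. qconj x \<in> Q_B}"
    have "qconj (x + y) = qconj x + qconj y" "qconj (x * y) = qconj y * qconj x"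
      by (simp_all add: qconj_def D_B_ops algebra_simps)
    with xy show "x + y \<in> {x \<in> Q_B. qconj x \<in> Q_B}" "x * y \<in> {x \<in> Q_B. qconj x \<in> Q_B}"
      by (simp_all add: Q_B_closed)
  qed
  moreover have "qconj \<alpha> = 1 - \<alpha>" "qconj \<beta> = 1 - \<beta>"
    by (simp_all add: qconj_def alpha_coords beta_coords one_D_B_def minus_D_B_def)
  then have "{\<alpha>, \<beta>} \<subseteq> {x \<in> Q_B. qconj x \<in> Q_B}"
    by (simp add: alpha_Q_B beta_Q_B Q_B_closed one_Q_B)
  ultimately have "Q_B \<subseteq> {x \<in> Q_B. qconj x \<in> Q_B}"
    unfolding Q_B_def[symmetric] by (subst Q_B_def) (rule hull_minimal)
  then show "x \<in> Q_B \<Longrightarrow> qconj x \<in> Q_B" by blast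
qed

lemma nrd_one: "nrd 1 = 1" and nrd_minus: "nrd (- x) = nrd x"
  by (simp_all add: nrd_def D_B_ops)

lemma Q_B1_group: "group Q_B1"
proof (rule groupI)
  fix x assume x: "x \<in> carrier Q_B1"
  have "nrd (qconj x) = nrd x" by (simp add: nrd_def qconj_def)
  with x show "\<exists>y\<in>carrier Q_B1. y \<otimes>\<^bsub>Q_B1\<^esub> x = \<one>\<^bsub>Q_B1\<^esub>"
    by (intro bexI[of _ "qconj x"]) (auto simp: Q_B1_def nrd_conj qconj_Q_B)
qed (auto simp: Q_B1_def Q_B_closed one_Q_B nrd_mult nrd_one mult.assoc)

lemma pm1_normal: "{1, - 1} \<lhd> Q_B1"
proof -
  interpret group Q_B1 by (rule Q_B1_group)
  have m: "- 1 \<in> carrier Q_B1" and o: "1 \<in> carrier Q_B1"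
    by (simp_all add: Q_B1_def Q_B_closed one_Q_B nrd_minus nrd_one Q_B_closed(3)[OF one_Q_B one_Q_B])
  have i: "inv\<^bsub>Q_B1\<^esub> (- 1) = - 1"
    by (rule inv_equality[OF _ m m]) (simp add: Q_B1_def)
  have i1: "inv\<^bsub>Q_B1\<^esub> 1 = 1"
    by (rule inv_equality[OF _ o o]) (simp add: Q_B1_def)
  have "subgroup {1, - 1} Q_B1"
    by (rule subgroupI) (use m o i i1 in \<open>auto simp: Q_B1_def\<close>)
  then show ?thesis
  proof (rule normal_invI)
    fix x h assume x: "x \<in> carrier Q_B1" and h: "h \<in> {1, - 1 :: D_B}"
    have "x \<otimes>\<^bsub>Q_B1\<^esub> h = h \<otimes>\<^bsub>Q_B1\<^esub> x" using h by (auto simp: Q_B1_def)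
    moreover have "h \<in> carrier Q_B1" using h m o by auto
    ultimately have "x \<otimes>\<^bsub>Q_B1\<^esub> h \<otimes>\<^bsub>Q_B1\<^esub> inv\<^bsub>Q_B1\<^esub> x = h"
      using x by (simp add: m_assoc)
    with h show "x \<otimes>\<^bsub>Q_B1\<^esub> h \<otimes>\<^bsub>Q_B1\<^esub> inv\<^bsub>Q_B1\<^esub> x \<in> {1, - 1}" by simp
  qed
qed

lemma PQ_B1_group: "group PQ_B1"
  unfolding PQ_B1_def by (rule normal.factorgroup_is_group[OF pm1_normal])

lemma mem_principal:
  "x \<in> ideal_times_Q_B (principal_OK c) \<longleftrightarrow> (\<exists>y\<in>Q_B. x = c *\<^sub>K y)"
proof
  assume "x \<in> ideal_times_Q_B (principal_OK c)"
  then obtain n :: nat and a z where x: "x = (\<Sum>k<n. a k *\<^sub>K z k)"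
    and az: "\<forall>k<n. a k \<in> principal_OK c \<and> z k \<in> Q_B"
    unfolding ideal_times_Q_B_def by blast
  from az have "\<exists>y\<in>Q_B. (\<Sum>k<n. a k *\<^sub>K z k) = c *\<^sub>K y"
  proof (induction n)
    case 0
    show ?case by (rule bexI[OF _ zero_Q_B]) simp
  next
    case (Suc n)
    then obtain y where y: "y \<in> Q_B" "(\<Sum>k<n. a k *\<^sub>K z k) = c *\<^sub>K y" by auto
    from Suc.prems obtain b where b: "b \<in> O_K" "a n = c * b" by (auto simp: principal_OK_def)
    have "y + b *\<^sub>K z n \<in> Q_B" using y b Suc.prems by (simp add: Q_B_closed scale_Q_B)
    moreover have "(\<Sum>k<Suc n. a k *\<^sub>K z k) = c *\<^sub>K (y + b *\<^sub>K z n)"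
      using y b by (simp add: D_B.scale_right_distrib)
    ultimately show ?case by blast
  qed
  with x show "\<exists>y\<in>Q_B. x = c *\<^sub>K y" by simp
next
  assume "\<exists>y\<in>Q_B. x = c *\<^sub>K y"
  then obtain y where y: "y \<in> Q_B" "x = c *\<^sub>K y" by blast
  have "c \<in> principal_OK c" using one_O_K by (force simp: principal_OK_def)
  with y show "x \<in> ideal_times_Q_B (principal_OK c)"
    unfolding ideal_times_Q_B_def
    by (intro CollectI exI[of _ "1::nat"] exI[of _ "\<lambda>_. c"] exI[of _ "\<lambda>_. y"]) simp
qed

lemma ideal_principal:
  assumes c: "c \<in> O_K"
  shows "ideal (ideal_times_Q_B (principal_OK c)) Q_B_ring"
proof (rule idealI[OF Q_B_ring])
  let ?J = "ideal_times_Q_B (principal_OK c)"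
  have sub: "?J \<subseteq> Q_B" using c by (auto simp: mem_principal scale_Q_B)
  have inv: "inv\<^bsub>add_monoid Q_B_ring\<^esub> x = - x" if "x \<in> Q_B" for x
  proof -
    interpret ring Q_B_ring by (rule Q_B_ring)
    show ?thesis
      by (rule group.inv_equality[OF a_group]) (use that in \<open>auto simp: Q_B_ring_def Q_B_closed\<close>)
  qed
  show "subgroup ?J (add_monoid Q_B_ring)"
  proof
    show "?J \<subseteq> carrier (add_monoid Q_B_ring)" using sub by (simp add: Q_B_ring_def)
    show "\<one>\<^bsub>add_monoid Q_B_ring\<^esub> \<in> ?J"
      using zero_Q_B by (force simp: Q_B_ring_def mem_principal)
    fix x assume x: "x \<in> ?J"
    then obtain u where u: "u \<in> Q_B" "x = c *\<^sub>K u" by (auto simp: mem_principal)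
    have "- x = c *\<^sub>K (- u)" using u by simp
    then have "- x \<in> ?J" using u Q_B_closed(3)[OF u(1) u(1)] unfolding mem_principal by blast
    moreover have "inv\<^bsub>add_monoid Q_B_ring\<^esub> x = - x" using x sub by (intro inv) blast
    ultimately show "inv\<^bsub>add_monoid Q_B_ring\<^esub> x \<in> ?J" by (simp only:)
    fix y assume "y \<in> ?J"
    then obtain v where v: "v \<in> Q_B" "y = c *\<^sub>K v" by (auto simp: mem_principal)
    have "x + y = c *\<^sub>K (u + v)" using u v by (simp add: D_B.scale_right_distrib)
    then show "x \<otimes>\<^bsub>add_monoid Q_B_ring\<^esub> y \<in> ?J"
      using u v Q_B_closed(1) by (auto simp: Q_B_ring_def mem_principal)
  qed
  fix a x assume ax: "a \<in> ?J" "x \<in> carrier Q_B_ring"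
  then obtain u where u: "u \<in> Q_B" "a = c *\<^sub>K u" by (auto simp: mem_principal)
  have x: "x \<in> Q_B" using ax by (simp add: Q_B_ring_def)
  have "x * a = c *\<^sub>K (x * u)" "a * x = c *\<^sub>K (u * x)"
    using scale_mult[of 1 x c u] scale_mult[of c u 1 x] u by simp_all
  then show "x \<otimes>\<^bsub>Q_B_ring\<^esub> a \<in> ?J" "a \<otimes>\<^bsub>Q_B_ring\<^esub> x \<in> ?J"
    using u x Q_B_closed(2) by (auto simp: Q_B_ring_def mem_principal)
qed

lemma mem_Q_B1_cong:
  "x \<in> Q_B1_cong (principal_OK c) \<longleftrightarrow>
    x \<in> Q_B \<and> nrd x = 1 \<and> (\<exists>y\<in>Q_B. x - 1 = c *\<^sub>K y)"
proof -
  let ?J = "ideal_times_Q_B (principal_OK c)"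
  have coset: "?J +>\<^bsub>Q_B_ring\<^esub> z = {h + z | h. h \<in> ?J}" for z
    by (auto simp: a_r_coset_def r_coset_def Q_B_ring_def)
  have key: "(?J +>\<^bsub>Q_B_ring\<^esub> x = ?J +>\<^bsub>Q_B_ring\<^esub> 1) \<longleftrightarrow> x - 1 \<in> ?J"
  proof
    assume e: "?J +>\<^bsub>Q_B_ring\<^esub> x = ?J +>\<^bsub>Q_B_ring\<^esub> 1"
    have "0 \<in> ?J" using zero_Q_B by (force simp: mem_principal)
    then have "x \<in> ?J +>\<^bsub>Q_B_ring\<^esub> x" unfolding coset by force
    then have "x \<in> ?J +>\<^bsub>Q_B_ring\<^esub> 1" by (simp only: e)
    then show "x - 1 \<in> ?J" unfolding coset by auto
  next
    assume j: "x - 1 \<in> ?J"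
    have p: "g + h \<in> ?J" "g - h \<in> ?J" if gh: "g \<in> ?J" "h \<in> ?J" for g h
    proof -
      obtain u v where uv: "u \<in> Q_B" "g = c *\<^sub>K u" "v \<in> Q_B" "h = c *\<^sub>K v"
        using gh by (auto simp: mem_principal)
      have "g + h = c *\<^sub>K (u + v)" "g - h = c *\<^sub>K (u - v)"
        using uv by (simp_all add: D_B.scale_right_distrib D_B.scale_right_diff_distrib)
      then show "g + h \<in> ?J" "g - h \<in> ?J"
        using Q_B_closed(1,4)[OF uv(1,3)] unfolding mem_principal by (metis, metis)
    qed
    have "\<exists>h'. h + x = h' + 1 \<and> h' \<in> ?J" if "h \<in> ?J" for h
    proof (intro exI conjI)
      show "h + x = (h + (x - 1)) + 1" by (simp only: add_diff_eq diff_add_cancel)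
      show "h + (x - 1) \<in> ?J" using that j by (rule p)
    qed
    moreover have "\<exists>h'. h + 1 = h' + x \<and> h' \<in> ?J" if "h \<in> ?J" for h
    proof (intro exI conjI)
      show "h + 1 = (h - (x - 1)) + x" by simp
      show "h - (x - 1) \<in> ?J" using that j by (rule p)
    qed
    ultimately have "{h + x | h. h \<in> ?J} \<subseteq> {h + 1 | h. h \<in> ?J}"
      "{h + 1 | h. h \<in> ?J} \<subseteq> {h + x | h. h \<in> ?J}"
      unfolding subset_iff mem_Collect_eq by metis+
    then show "?J +>\<^bsub>Q_B_ring\<^esub> x = ?J +>\<^bsub>Q_B_ring\<^esub> 1"
      unfolding coset by (rule equalityI)
  qed
  have "x \<in> Q_B1_cong (principal_OK c) \<longleftrightarrow> x \<in> Q_B \<and> nrd x = 1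
      \<and> ?J +>\<^bsub>Q_B_ring\<^esub> x = ?J +>\<^bsub>Q_B_ring\<^esub> 1"
    unfolding Q_B1_cong_def kernel_def units_of_one FactRing_def
    by (simp add: Q_B1_def Q_B_ring_def)
  then show ?thesis unfolding key mem_principal .
qed

end

theory Submission
  imports Defs
begin

text \<open>
The group \<open>Q_B1 / {1, -1}\<close> acts on the hyperbolic plane as the \<open>(3,3,4)\<close> triangle group, and the
Bolza group turns out to be a congruence subgroup itself. Let \<open>\<gamma> = \<alpha>\<beta>\<close>, an element of order four modulo
\<open>-1\<close>, and \<open>\<pi> = 1 - \<gamma>\<close>. The reduced norm of \<open>\<pi>\<close> is \<open>sqrt 2 (1 + sqrt 2)\<close>, and \<open>\<pi>\<close> normalises the order, so
\<open>P = \<pi> Q_B\<close> is the two-sided prime ideal above the ramified prime \<open>sqrt 2\<close>, with \<open>P\<^sup>2 = sqrt 2 Q_B\<close>.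
The core result is \<open>Bolza_lift_congruence\<close>: the preimage of the Bolza group in \<open>Q_B1\<close> consists of the
elements that are \<open>1\<close> modulo \<open>P\<^sup>3 = sqrt 2 P\<close>. Since \<open>2 Q_B = P\<^sup>4\<close> and \<open>sqrt 2 Q_B = P\<^sup>2\<close>, both inclusions
follow; strictness is witnessed by the defining relator, which is not \<open>1\<close> modulo \<open>2\<close>, and by \<open>\<gamma>\<^sup>2\<close>, which
is \<open>1\<close> modulo \<open>sqrt 2\<close> and has trace \<open>0\<close>.

One half of the core result is a computation: the relator is \<open>1\<close> modulo \<open>P\<^sup>3\<close>, and congruence subgroups
are normal. The other half compares sizes without computing an index. If \<open>\<alpha>\<close> and \<open>\<beta>\<close> generate \<open>Q_B1\<close>
up to sign, then the relations \<open>\<alpha>\<^sup>3 = \<beta>\<^sup>3 = \<gamma>\<^sup>4 = -1\<close> together with the relator already cut the quotient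
by the Bolza group down to the \<open>24\<close> classes \<open>\<alpha>\<^sup>i \<gamma>\<^sup>k \<delta>\<^sup>l\<close> with \<open>i < 3\<close>, \<open>k < 4\<close>, \<open>l < 2\<close>, where
\<open>\<delta> = \<beta>\<alpha>\<close> (\<open>coset_representatives\<close>); abstractly this is the binary tetrahedral group, with \<open>\<gamma>\<close> and \<open>\<delta>\<close>
generating its quaternion subgroup. An element that is \<open>1\<close> modulo \<open>P\<^sup>3\<close> has trace \<open>2\<close> modulo
\<open>2 sqrt 2\<close>, and of the \<open>24\<close> representatives only the identity passes this test
(\<open>representative_trivial\<close>).

Generation (\<open>Q_B1_generated\<close>) is a descent. Let \<open>z\<close> be the fixed point of \<open>\<gamma>\<close> in the hyperbolic plane.
Its orbit consists of the centres of a tessellation by regular octagons meeting three at a vertex;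
the eight neighbours of \<open>z\<close> are the points \<open>\<gamma>\<^sup>k \<alpha> z\<close> and \<open>\<gamma>\<^sup>k \<alpha>\<^sup>-\<^sup>1 z\<close>. If \<open>g z\<close> lies outside the
octagon of \<open>z\<close>, one of these neighbours is closer to \<open>g z\<close> than \<open>z\<close> is, and dividing by the
corresponding group element reduces the distance (\<open>height_descent\<close>). What makes this an elementary
argument is that \<open>height g\<close>, the hyperbolic cosine of the distance from \<open>z\<close> to \<open>g z\<close>, is an algebraic integer
of \<open>K\<close>, while its conjugate lies in \<open>[-1, 1]\<close> because the other real place of the quaternion algebra
is definite. So the height takes discrete values, and below \<open>sqrt 2\<close>, which exceeds the hyperbolic cosine
of the circumradius of the octagon, the only value is \<open>1\<close>; height \<open>1\<close> means that \<open>g\<close> fixes \<open>z\<close>, and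
such \<open>g\<close> are up to sign powers of \<open>\<gamma>\<close>.
\<close>

section \<open>The two real embeddings\<close>

lemma real_of_K_simps [simp]:
  "real_of_K 0 = 0" "real_of_K 1 = 1" "real_of_K (x + y) = real_of_K x + real_of_K y"
  "real_of_K (x - y) = real_of_K x - real_of_K y" "real_of_K (- x) = - real_of_K x"
  "real_of_K (x * y) = real_of_K x * real_of_K y" "real_of_K sqrt2 = sqrt 2"
  "real_of_K (inverse x) = inverse (real_of_K x)"
  by (simp_all add: zero_qsqrt2.rep_eq one_qsqrt2.rep_eq plus_qsqrt2.rep_eq minus_qsqrt2.rep_eq
      uminus_qsqrt2.rep_eq times_qsqrt2.rep_eq sqrt2.rep_eq inverse_qsqrt2.rep_eq)

lemma real_of_K_divide [simp]: "real_of_K (x / y) = real_of_K x / real_of_K y"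
  by (simp only: divide_qsqrt2_def divide_inverse real_of_K_simps)

lemma real_of_K_of_nat [simp]: "real_of_K (of_nat n) = of_nat n"
  by (induction n) simp_all

lemma real_of_K_numeral [simp]: "real_of_K (numeral n) = numeral n"
  using real_of_K_of_nat[of "numeral n"] by simp

lemma real_of_K_of_int [simp]: "real_of_K (of_int n) = of_int n"
  by (cases n) simp_all

lemma real_of_K_power [simp]: "real_of_K (x ^ n) = real_of_K x ^ n"
  by (induction n) simp_all

lemma rational_coordinates_unique:
  fixes a b c d :: rat
  assumes "of_rat a + of_rat b * sqrt 2 = (of_rat c + of_rat d * sqrt 2 :: real)"
  shows "a = c \<and> b = d"
proof -
  have e: "of_rat (b - d) * sqrt 2 = (of_rat (c - a) :: real)"
    using assms by (simp add: of_rat_diff algebra_simps)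
  have "b = d"
  proof (rule ccontr)
    assume "b \<noteq> d"
    then have nz: "(of_rat (b - d) :: real) \<noteq> 0" by simp
    have "sqrt 2 = of_rat (c - a) / of_rat (b - d)"
      using e nz by (simp add: nonzero_eq_divide_eq mult.commute)
    also have "\<dots> \<in> \<rat>" by (intro Rats_divide Rats_of_rat)
    finally show False using sqrt_2_irrational by simp
  qed
  with e show ?thesis by simp
qed

text \<open>The embedding of \<open>K\<close> that sends \<open>sqrt 2\<close> to \<open>- sqrt 2\<close>; the rational coordinates of an element are unique
because \<open>sqrt 2\<close> is irrational.\<close>

definition conj_of_K :: "qsqrt2 \<Rightarrow> real"
  where "conj_of_K x = (THE y. \<exists>a b. real_of_K x = of_rat a + of_rat b * sqrt 2
    \<and> y = of_rat a - of_rat b * sqrt 2)"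

lemma conj_of_K_eqI:
  assumes "real_of_K x = of_rat a + of_rat b * sqrt 2"
  shows "conj_of_K x = of_rat a - of_rat b * sqrt 2"
  unfolding conj_of_K_def
proof (rule the_equality)
  show "\<exists>c d. real_of_K x = of_rat c + of_rat d * sqrt 2
      \<and> of_rat a - of_rat b * sqrt 2 = of_rat c - of_rat d * sqrt 2"
    using assms by blast
next
  fix y assume "\<exists>c d. real_of_K x = of_rat c + of_rat d * sqrt 2 \<and> y = of_rat c - of_rat d * sqrt 2"
  then show "y = of_rat a - of_rat b * sqrt 2"
    using assms rational_coordinates_unique by metis
qed

lemma conj_of_K_obtain:
  obtains a b where "real_of_K x = of_rat a + of_rat b * sqrt 2"
    "conj_of_K x = of_rat a - of_rat b * sqrt 2"
  using real_of_K[of x] conj_of_K_eqI by blast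

lemma conj_of_K_add [simp]: "conj_of_K (x + y) = conj_of_K x + conj_of_K y"
proof -
  obtain a b where x: "real_of_K x = of_rat a + of_rat b * sqrt 2"
    "conj_of_K x = of_rat a - of_rat b * sqrt 2" by (rule conj_of_K_obtain)
  obtain c d where y: "real_of_K y = of_rat c + of_rat d * sqrt 2"
    "conj_of_K y = of_rat c - of_rat d * sqrt 2" by (rule conj_of_K_obtain)
  have "real_of_K (x + y) = of_rat (a + c) + of_rat (b + d) * sqrt 2"
    using x y by (simp add: of_rat_add algebra_simps)
  from conj_of_K_eqI[OF this] show ?thesis using x y by (simp add: of_rat_add algebra_simps)
qed

lemma conj_of_K_mult [simp]: "conj_of_K (x * y) = conj_of_K x * conj_of_K y"
proof -
  obtain a b where x: "real_of_K x = of_rat a + of_rat b * sqrt 2"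
    "conj_of_K x = of_rat a - of_rat b * sqrt 2" by (rule conj_of_K_obtain)
  obtain c d where y: "real_of_K y = of_rat c + of_rat d * sqrt 2"
    "conj_of_K y = of_rat c - of_rat d * sqrt 2" by (rule conj_of_K_obtain)
  have "real_of_K (x * y) = of_rat (a * c + 2 * b * d) + of_rat (a * d + b * c) * sqrt 2"
    using x y by (simp add: of_rat_add of_rat_mult algebra_simps)
  from conj_of_K_eqI[OF this] show ?thesis
    unfolding x(2) y(2) by (simp add: of_rat_add of_rat_mult algebra_simps)
qed

lemma conj_of_K_of_int [simp]: "conj_of_K (of_int n) = of_int n"
  using conj_of_K_eqI[of "of_int n" "of_int n" 0] by simp

lemma conj_of_K_simps [simp]:
  "conj_of_K 0 = 0" "conj_of_K 1 = 1" "conj_of_K (numeral k) = numeral k"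
  using conj_of_K_of_int[of 0] conj_of_K_of_int[of 1] conj_of_K_of_int[of "numeral k"] by simp_all

lemma conj_of_K_sqrt2 [simp]: "conj_of_K sqrt2 = - sqrt 2"
  using conj_of_K_eqI[of sqrt2 0 1] by simp

lemma conj_of_K_uminus [simp]: "conj_of_K (- x) = - conj_of_K x"
  using conj_of_K_add[of x "- x"] by simp

lemma conj_of_K_diff [simp]: "conj_of_K (x - y) = conj_of_K x - conj_of_K y"
  using conj_of_K_add[of x "- y"] by simp

lemma conj_of_K_power [simp]: "conj_of_K (x ^ n) = conj_of_K x ^ n"
  by (induction n) simp_all

lemma of_int_sqrt2_unique:
  assumes "of_int a + of_int b * sqrt2 = of_int c + of_int d * sqrt2"
  shows "a = c \<and> b = d"
proof -
  have "real_of_K (of_int a + of_int b * sqrt2) = real_of_K (of_int c + of_int d * sqrt2)"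
    using assms by simp
  then have "of_rat (of_int a) + of_rat (of_int b) * sqrt 2
      = (of_rat (of_int c) + of_rat (of_int d) * sqrt 2 :: real)" by simp
  then show ?thesis using rational_coordinates_unique by (metis of_int_eq_iff)
qed

section \<open>An integral basis of the order\<close>

definition \<gamma> :: D_B where "\<gamma> = \<alpha> * \<beta>"
definition \<delta> :: D_B where "\<delta> = \<beta> * \<alpha>"

lemma gamma_coords: "\<gamma> = Quat (- sqrt2 / 2) ((2 + sqrt2) / 6) (1/2) (- 1/6)"
  by (simp add: \<gamma>_def alpha_coords beta_coords times_D_B_def field_simps)

definition lin :: "qsqrt2 \<Rightarrow> qsqrt2 \<Rightarrow> qsqrt2 \<Rightarrow> qsqrt2 \<Rightarrow> D_B"
  where "lin a b c d = a *\<^sub>K 1 + b *\<^sub>K \<alpha> + c *\<^sub>K \<beta> + d *\<^sub>K \<gamma>"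

lemma lin_coords: "lin a b c d = Quat (a + b / 2 + c / 2 - d * sqrt2 / 2)
    (b / 2 + c * (1 + 2 * sqrt2) / 6 + d * (2 + sqrt2) / 6) (d / 2) (- c / 3 - d / 6)"
  by (simp add: lin_def scale_def plus_D_B_def one_D_B_def alpha_coords beta_coords gamma_coords)

lemma lin_add: "lin a b c d + lin a' b' c' d' = lin (a + a') (b + b') (c + c') (d + d')"
  by (simp add: lin_def D_B.scale_left_distrib)

lemma lin_scale: "k *\<^sub>K lin a b c d = lin (k * a) (k * b) (k * c) (k * d)"
  by (simp add: lin_def D_B.scale_right_distrib)

text \<open>The multiplication table of the basis \<open>1, \<alpha>, \<beta>, \<gamma>\<close>. Its entries are integral, so the \<open>O_K\<close>-span of the
basis is closed under products.\<close>

lemma lin_mult: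
  "lin x0 x1 x2 x3 * lin y0 y1 y2 y3 = lin
    (x0*y0 - x1*y1 - (1 + sqrt2)*x2*y1 - x2*y2 - x2*y3 - x3*y1 - x3*y3)
    (x0*y1 + x1*y0 + x1*y1 + x2*y1 + x2*y3 - sqrt2*x3*y1 - x3*y2)
    (x0*y2 + x2*y0 - x1*y3 + x2*y1 + x2*y2 - sqrt2*x2*y3 + x3*y1)
    (x0*y3 + x3*y0 + x1*y2 + x1*y3 - x2*y1 + x3*y2 - sqrt2*x3*y3)"
  unfolding lin_coords times_D_B_def D_B.sel D_B.inject
  by (intro conjI) (simp_all add: field_simps sqrt2_squared sqrt2_sqrt2)

lemma lin_inject:
  "lin a b c d = lin a' b' c' d' \<longleftrightarrow> a = a' \<and> b = b' \<and> c = c' \<and> d = d'"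
  by (auto simp: lin_coords)

text \<open>The order is defined as an intersection of subalgebras; an explicit basis is what makes traces and
norms visibly integral and decides membership in ideals by coordinates.\<close>

lemma Q_B_lin: "Q_B = {lin a b c d | a b c d. a \<in> O_K \<and> b \<in> O_K \<and> c \<in> O_K \<and> d \<in> O_K}"
  (is "_ = ?L")
proof
  have "OK_subalgebra ?L"
    unfolding OK_subalgebra_def
  proof (intro conjI ballI)
    have "1 = lin 1 0 0 0" by (simp add: lin_def)
    then show "1 \<in> ?L" using one_O_K zero_O_K by blast
  next
    fix k x assume k: "k \<in> O_K" "x \<in> ?L"
    then show "k *\<^sub>K x \<in> ?L" by clarsimp (metis lin_scale O_K_closed(3))
  next
    fix x y assume "x \<in> ?L" "y \<in> ?L"
    then obtain a b c d a' b' c' d' where x: "x = lin a b c d" "a \<in> O_K" "b \<in> O_K" "c \<in> O_K" "d \<in> O_K"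
      and y: "y = lin a' b' c' d'" "a' \<in> O_K" "b' \<in> O_K" "c' \<in> O_K" "d' \<in> O_K" by blast
    show "x + y \<in> ?L"
      unfolding x y lin_add using x y by (blast intro: O_K_closed)
    show "x * y \<in> ?L"
      unfolding x y lin_mult mem_Collect_eq
      by (intro exI conjI, rule refl) (intro O_K_closed x y one_O_K sqrt2_O_K)+
  qed
  moreover have "\<alpha> = lin 0 1 0 0" "\<beta> = lin 0 0 1 0" by (simp_all add: lin_def)
  then have "{\<alpha>, \<beta>} \<subseteq> ?L" using one_O_K zero_O_K by blast
  ultimately show "Q_B \<subseteq> ?L" unfolding Q_B_def by (rule hull_minimal[rotated])
  show "?L \<subseteq> Q_B"
    unfolding lin_def \<gamma>_def
    by (auto intro!: Q_B_closed scale_Q_B one_Q_B alpha_Q_B beta_Q_B)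
qed

lemma two_O_K: "2 \<in> O_K"
  using of_int_O_K[of 2] by simp

lemma uminus_O_K: "x \<in> O_K \<Longrightarrow> - x \<in> O_K"
  using O_K_closed(2)[OF zero_O_K] by force

lemma trace_O_K: "x \<in> Q_B \<Longrightarrow> 2 * co1 x \<in> O_K"
proof -
  assume "x \<in> Q_B"
  then obtain a b c d where x: "x = lin a b c d" "a \<in> O_K" "b \<in> O_K" "c \<in> O_K" "d \<in> O_K"
    unfolding Q_B_lin by blast
  have "2 * co1 x = 2 * a + b + c - d * sqrt2" by (simp add: x lin_coords field_simps)
  then show ?thesis using x by (simp add: O_K_closed two_O_K sqrt2_O_K)
qed

lemma scalar_Q_B: "k *\<^sub>K 1 \<in> Q_B \<longleftrightarrow> k \<in> O_K"
proof
  have "k *\<^sub>K 1 = lin k 0 0 0" by (simp add: lin_def)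
  then show "k *\<^sub>K 1 \<in> Q_B \<Longrightarrow> k \<in> O_K" unfolding Q_B_lin by (auto simp: lin_inject)
qed (rule scale_Q_B[OF _ one_Q_B])

lemma nrd_O_K: "x \<in> Q_B \<Longrightarrow> nrd x \<in> O_K"
  using Q_B_closed(2)[OF _ qconj_Q_B] by (metis nrd_conj(1) scalar_Q_B)

section \<open>The displacement of the order-four point\<close>

lemma qconj_mult: "qconj (x * y) = qconj y * qconj x"
  by (simp add: qconj_def D_B_ops algebra_simps)

lemma qconj_qconj [simp]: "qconj (qconj x) = x"
  by (simp add: qconj_def)

lemma nrd_qconj [simp]: "nrd (qconj x) = nrd x"
  by (simp add: nrd_def qconj_def)

lemma qconj_uminus [simp]: "qconj (- x) = - qconj x"
  by (simp add: qconj_def uminus_D_B_def)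

lemma qconj_one [simp]: "qconj 1 = 1"
  by (simp add: qconj_def one_D_B_def)

lemma co1_mult_commute: "co1 (x * y) = co1 (y * x)"
  by (simp add: times_D_B_def algebra_simps)

lemma nrd_one_inverse:
  assumes "nrd x = 1"
  shows "x * qconj x = 1" "qconj x * x = 1" "x * (qconj x * y) = y" "qconj x * (x * y) = y"
    using assms by (simp_all add: nrd_conj mult.assoc[symmetric])

lemma co1_simps [simp]: "co1 (x + y) = co1 x + co1 y" "co1 (x - y) = co1 x - co1 y"
  "co1 (- x) = - co1 x" "co1 (k *\<^sub>K x) = k * co1 x" "co1 0 = 0" "co1 1 = 1" "co1 (qconj x) = co1 x"
  by (simp_all add: D_B_ops scale_def qconj_def)

lemma scale_mult_left [simp]: "(k *\<^sub>K x) * y = k *\<^sub>K (x * y)"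
  and scale_mult_right [simp]: "x * (k *\<^sub>K y) = k *\<^sub>K (x * y)"
  using scale_mult[of k x 1 y] scale_mult[of 1 x k y] by simp_all

lemma nrd_gamma: "nrd \<gamma> = 1"
  by (simp add: \<gamma>_def nrd_mult nrd_alpha nrd_beta)

lemma nrd_delta: "nrd \<delta> = 1"
  by (simp add: \<delta>_def nrd_mult nrd_alpha nrd_beta)

lemma gamma_Q_B: "\<gamma> \<in> Q_B" and delta_Q_B: "\<delta> \<in> Q_B"
  by (simp_all add: \<gamma>_def \<delta>_def Q_B_closed alpha_Q_B beta_Q_B)

text \<open>A trace-free element commuting with \<open>\<gamma>\<close>. Trace-free quaternions of norm \<open>2\<close> form a two-sheeted hyperboloid,
a model of the hyperbolic plane on which the norm one group acts by conjugation; the point \<open>axis\<close> of it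
is the fixed point of \<open>\<gamma>\<close>.\<close>

definition axis :: D_B where "axis = Quat 0 ((2 + sqrt2) / 3) 1 (- 1/3)"

lemma gamma_axis: "\<gamma> = (1/2) *\<^sub>K (axis - sqrt2 *\<^sub>K 1)"
  by (simp add: gamma_coords axis_def scale_def minus_D_B_def one_D_B_def)

text \<open>Two orthogonal directions at \<open>axis\<close>, swapped up to sign by the quarter turn \<open>\<gamma>\<close>. They are chosen such that
the eight neighbours of \<open>axis\<close> have simple coordinates: \<open>tangent1\<close> is the tangential part of the image
of \<open>axis\<close> under \<open>\<alpha>\<close>, and \<open>1 + sqrt 2\<close> is the hyperbolic cosine of the distance to a neighbour.\<close>

definition tangent1 :: D_B
  where "tangent1 = Quat 0 (- (2 + 2 * sqrt2) / 3) (- (1 + sqrt2)) (1 + sqrt2 / 3)"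
definition tangent2 :: D_B
  where "tangent2 = Quat 0 (2 / 3) (1 + sqrt2) ((1 + sqrt2) / 3)"

lemma gamma_axis_commute: "\<gamma> * axis * qconj \<gamma> = axis"
  by (simp add: gamma_coords axis_def times_D_B_def qconj_def field_simps sqrt2_squared sqrt2_sqrt2)

lemma gamma_tangent1: "\<gamma> * tangent1 * qconj \<gamma> = tangent2"
  by (simp add: gamma_coords tangent1_def tangent2_def times_D_B_def qconj_def field_simps
    sqrt2_squared sqrt2_sqrt2)

lemma gamma_tangent2: "\<gamma> * tangent2 * qconj \<gamma> = - tangent1"
  by (simp add: gamma_coords tangent1_def tangent2_def times_D_B_def qconj_def field_simps
    sqrt2_squared sqrt2_sqrt2 uminus_D_B_def)

lemma alpha_axis: "\<alpha> * axis * qconj \<alpha> = (1 + sqrt2) *\<^sub>K axis + tangent1"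
  by (simp add: alpha_coords tangent1_def axis_def times_D_B_def qconj_def field_simps
    sqrt2_squared sqrt2_sqrt2 plus_D_B_def scale_def)

lemma conj_alpha_axis:
  "qconj \<alpha> * axis * \<alpha> = (1 + sqrt2) *\<^sub>K axis + (sqrt2 / 2) *\<^sub>K (tangent1 - tangent2)"
  by (simp add: alpha_coords tangent1_def tangent2_def axis_def times_D_B_def qconj_def field_simps
    sqrt2_squared sqrt2_sqrt2 plus_D_B_def minus_D_B_def scale_def)

text \<open>The polar form of half the reduced norm on trace-free quaternions. Between two points of the hyperboloid
it is the hyperbolic cosine of their distance, so that \<open>height g\<close> measures how far \<open>g\<close> moves \<open>axis\<close>.\<close>

definition pairing :: "D_B \<Rightarrow> D_B \<Rightarrow> qsqrt2"
  where "pairing x y = - co1 (x * y) / 2"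

definition height :: "D_B \<Rightarrow> qsqrt2"
  where "height g = pairing axis (g * axis * qconj g)"

lemma pairing_add: "pairing (x + y) z = pairing x z + pairing y z"
  and pairing_diff: "pairing (x - y) z = pairing x z - pairing y z"
  and pairing_uminus: "pairing (- x) z = - pairing x z"
  and pairing_scale: "pairing (k *\<^sub>K x) z = k * pairing x z"
  by (simp_all add: pairing_def field_simps)

lemma height_translate:
  "height (qconj s * g) = pairing (s * axis * qconj s) (g * axis * qconj g)"
  unfolding height_def pairing_def qconj_mult qconj_qconj
  using co1_mult_commute[of "axis * qconj s * g * axis * qconj g" s]
  by (simp add: mult.assoc)

text \<open>Expanding \<open>axis = 2\<gamma> + sqrt 2\<close> shows that the height is \<open>1\<close> minus the trace of an element of the order.\<close>

lemma height_O_K: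
  assumes "g \<in> Q_B" "nrd g = 1"
  shows "height g \<in> O_K"
proof -
  define t where "t = \<gamma> * (g * \<gamma> * qconj g)"
  have "t \<in> Q_B" unfolding t_def using assms by (simp add: Q_B_closed gamma_Q_B qconj_Q_B)
  then have t: "1 - 2 * co1 t \<in> O_K" by (intro O_K_closed one_O_K trace_O_K)
  have "t = (1/4) *\<^sub>K (axis * (g * axis * qconj g) - sqrt2 *\<^sub>K axis
      - sqrt2 *\<^sub>K (g * axis * qconj g) + 2 *\<^sub>K 1)"
    unfolding t_def gamma_axis using nrd_one_inverse[OF assms(2)]
    by (simp add: algebra_simps sqrt2_squared)
  moreover have "co1 axis = 0" by (simp add: axis_def)
  moreover have "co1 (g * axis * qconj g) = 0"
    using co1_mult_commute[of "g * axis" "qconj g"] nrd_one_inverse[OF assms(2)]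
    by (simp add: mult.assoc[symmetric] axis_def)
  ultimately have "co1 t = (1/4) * (co1 (axis * (g * axis * qconj g)) + 2)"
    by (simp only: co1_simps) simp
  then have "1 - 2 * co1 t = height g"
    by (simp add: height_def pairing_def field_simps)
  with t show ?thesis by simp
qed

text \<open>The equation \<open>cosh\<^sup>2 - 1 = sinh\<^sup>2\<close> in coordinates. It is an identity over \<open>K\<close>, so it may be read at both real
places: at the second one the factor \<open>2 + 2 sqrt 2\<close> becomes negative, which bounds the conjugate of the
height.\<close>

lemma height_hyperboloid:
  fixes g
  defines "P \<equiv> g * axis * qconj g"
  assumes "nrd g = 1"
  shows "(2 + 2 * sqrt2) * ((height g)\<^sup>2 - 1) = (pairing tangent1 P)\<^sup>2 + (pairing tangent2 P)\<^sup>2"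
proof -
  have n: "nrd P = 2"
    unfolding P_def nrd_mult nrd_qconj using assms(2)
    by (simp add: nrd_def axis_def field_simps power2_eq_square sqrt2_squared sqrt2_sqrt2)
  have c: "co1 P = 0"
    unfolding P_def
    using co1_mult_commute[of "g * axis" "qconj g"] nrd_one_inverse[OF assms(2)]
    by (simp add: mult.assoc[symmetric] axis_def)
  obtain a p q r where P: "P = Quat a p q r" by (cases P)
  have a: "a = 0" using c P by simp
  have nP: "3 * p\<^sup>2 - sqrt2 * q\<^sup>2 - 3 * sqrt2 * r\<^sup>2 = 2" using n unfolding P a nrd_def by simp
  have h: "2 * height g = (2 + sqrt2) * p - sqrt2 * q + sqrt2 * r"
    unfolding height_def P_def[symmetric] unfolding pairing_def P a axis_def
    by (simp add: times_D_B_def field_simps)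
  have t1: "2 * pairing tangent1 P = - (2 + 2 * sqrt2) * p + (sqrt2 + 2) * q - (3 * sqrt2 + 2) * r"
    unfolding pairing_def P a tangent1_def
    by (simp add: times_D_B_def field_simps sqrt2_squared sqrt2_sqrt2)
  have t2: "2 * pairing tangent2 P = 2 * p - (sqrt2 + 2) * q - (sqrt2 + 2) * r"
    unfolding pairing_def P a tangent2_def
    by (simp add: times_D_B_def field_simps sqrt2_squared sqrt2_sqrt2)
  have "(2 + 2 * sqrt2) * ((2 * height g)\<^sup>2 - 2 * (3 * p\<^sup>2 - sqrt2 * q\<^sup>2 - 3 * sqrt2 * r\<^sup>2))
      = (2 * pairing tangent1 P)\<^sup>2 + (2 * pairing tangent2 P)\<^sup>2"
    unfolding h t1 t2
    by (simp add: algebra_simps power2_eq_square sqrt2_squared sqrt2_sqrt2)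
  then have "4 * ((2 + 2 * sqrt2) * ((height g)\<^sup>2 - 1))
      = 4 * ((pairing tangent1 P)\<^sup>2 + (pairing tangent2 P)\<^sup>2)"
    unfolding nP by (simp add: algebra_simps)
  then show ?thesis by (simp only: mult_cancel_left) simp
qed

text \<open>Splitting \<open>g\<close> into a part commuting with \<open>axis\<close> and a part anticommuting with it, with norms \<open>N\<close> and \<open>-M\<close>,
the norm is \<open>N - M\<close> and the height is \<open>N + M\<close>. The difference \<open>2 M\<close> is nonnegative at the first real
place, being a positive multiple of a sum of squares.\<close>

lemma height_minus_nrd:
  "(2 + 2 * sqrt2) * (height g - nrd g) = (co1 (g * tangent1))\<^sup>2 + (co1 (g * tangent2))\<^sup>2"
proof -
  obtain a p q r where g: "g = Quat a p q r" by (cases g)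
  show ?thesis
    unfolding g height_def pairing_def axis_def tangent1_def tangent2_def nrd_def qconj_def
      times_D_B_def D_B.sel
    by (simp add: field_simps power2_eq_square sqrt2_squared sqrt2_sqrt2)
qed

lemma height_ge_one:
  assumes "nrd g = 1"
  shows "real_of_K (height g) \<ge> 1"
proof -
  have "real_of_K ((2 + 2 * sqrt2) * (height g - nrd g)) \<ge> 0"
    unfolding height_minus_nrd by simp
  then have "(2 + 2 * sqrt 2) * (real_of_K (height g) - 1) \<ge> 0"
    using assms by simp
  moreover have "2 + 2 * sqrt 2 > 0" by (simp add: add_pos_pos)
  ultimately have "real_of_K (height g) - 1 \<ge> 0" by (simp only: zero_le_mult_iff) linarith
  then show ?thesis by simp
qed

lemma conj_height_bound:
  assumes "nrd g = 1"
  shows "\<bar>conj_of_K (height g)\<bar> \<le> 1"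
proof -
  have "conj_of_K ((2 + 2 * sqrt2) * ((height g)\<^sup>2 - 1)) \<ge> 0"
    unfolding height_hyperboloid[OF assms] by simp
  then have "(2 - 2 * sqrt 2) * ((conj_of_K (height g))\<^sup>2 - 1) \<ge> 0" by simp
  moreover have "2 - 2 * sqrt 2 < 0" by simp
  ultimately have "(conj_of_K (height g))\<^sup>2 - 1 \<le> 0" by (simp only: zero_le_mult_iff) linarith
  then show ?thesis using abs_le_square_iff[of "conj_of_K (height g)" 1] by simp
qed

text \<open>The three inequalities cut out a regular octagon of inradius \<open>sqrt 2 f\<close>, and the bound is the square of
its circumradius. In each of the eight sectors the farthest point from the centre is a corner.\<close>

lemma octagon_bound:
  fixes f x y :: real
  assumes f: "f > 0" and x: "\<bar>x\<bar> \<le> sqrt 2 * f" and y: "\<bar>y\<bar> \<le> sqrt 2 * f"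
    and xy: "\<bar>x\<bar> + \<bar>y\<bar> \<le> 2 * f"
  shows "x\<^sup>2 + y\<^sup>2 \<le> (8 - 4 * sqrt 2) * f\<^sup>2"
proof -
  have *: "a\<^sup>2 + b\<^sup>2 \<le> (8 - 4 * sqrt 2) * f\<^sup>2"
    if ab: "0 \<le> b" "b \<le> a" "a \<le> sqrt 2 * f" "a + b \<le> 2 * f" for a b
  proof (cases "a \<le> f")
    case True
    then have "a\<^sup>2 \<le> f\<^sup>2" "b\<^sup>2 \<le> f\<^sup>2" using ab by (auto intro!: power_mono)
    moreover have "sqrt 2 \<le> 3 / 2" by (rule real_le_lsqrt) (simp_all add: power2_eq_square)
    then have "0 \<le> (6 - 4 * sqrt 2) * f\<^sup>2" by simp
    then have "2 * f\<^sup>2 \<le> (8 - 4 * sqrt 2) * f\<^sup>2"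
      by (simp add: algebra_simps)
    ultimately show ?thesis by linarith
  next
    case False
    have "b\<^sup>2 \<le> (2 * f - a)\<^sup>2" using ab by (intro power_mono) auto
    moreover have "(a - f)\<^sup>2 \<le> ((sqrt 2 - 1) * f)\<^sup>2"
      using ab False by (intro power_mono) (auto simp: algebra_simps)
    ultimately have "a\<^sup>2 + b\<^sup>2 \<le> 2 * ((sqrt 2 - 1) * f)\<^sup>2 + 2 * f\<^sup>2"
      by (simp add: power2_eq_square algebra_simps)
    also have "\<dots> = (8 - 4 * sqrt 2) * f\<^sup>2"
      by (simp add: power2_eq_square algebra_simps)
    finally show ?thesis .
  qed
  show ?thesis
    using *[of "\<bar>x\<bar>" "\<bar>y\<bar>"] *[of "\<bar>y\<bar>" "\<bar>x\<bar>"] assms by (cases "\<bar>x\<bar> \<le> \<bar>y\<bar>") auto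
qed

section \<open>Generation\<close>

text \<open>Conjugation by \<open>\<gamma>\<close> rotates the tangent plane by a right angle, so the eight neighbours arise from the two
images of \<open>axis\<close> under \<open>\<alpha>\<close> and its inverse.\<close>

lemma neighbour_axes:
  "(\<gamma> ^ 0 * \<alpha>) * axis * qconj (\<gamma> ^ 0 * \<alpha>) = (1 + sqrt2) *\<^sub>K axis + tangent1"
    "(\<gamma> ^ 1 * \<alpha>) * axis * qconj (\<gamma> ^ 1 * \<alpha>) = (1 + sqrt2) *\<^sub>K axis + tangent2"
    "(\<gamma> ^ 2 * \<alpha>) * axis * qconj (\<gamma> ^ 2 * \<alpha>) = (1 + sqrt2) *\<^sub>K axis - tangent1"
    "(\<gamma> ^ 3 * \<alpha>) * axis * qconj (\<gamma> ^ 3 * \<alpha>) = (1 + sqrt2) *\<^sub>K axis - tangent2"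
    "(\<gamma> ^ 0 * qconj \<alpha>) * axis * qconj (\<gamma> ^ 0 * qconj \<alpha>)
      = (1 + sqrt2) *\<^sub>K axis + (sqrt2 / 2) *\<^sub>K (tangent1 - tangent2)"
    "(\<gamma> ^ 1 * qconj \<alpha>) * axis * qconj (\<gamma> ^ 1 * qconj \<alpha>)
      = (1 + sqrt2) *\<^sub>K axis + (sqrt2 / 2) *\<^sub>K (tangent2 + tangent1)"
    "(\<gamma> ^ 2 * qconj \<alpha>) * axis * qconj (\<gamma> ^ 2 * qconj \<alpha>)
      = (1 + sqrt2) *\<^sub>K axis + (sqrt2 / 2) *\<^sub>K (tangent2 - tangent1)"
    "(\<gamma> ^ 3 * qconj \<alpha>) * axis * qconj (\<gamma> ^ 3 * qconj \<alpha>)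
      = (1 + sqrt2) *\<^sub>K axis + (sqrt2 / 2) *\<^sub>K (- tangent1 - tangent2)"
proof -
  define rot where "rot x = \<gamma> * x * qconj \<gamma>" for x
  have step: "(\<gamma> ^ Suc k * a) * axis * qconj (\<gamma> ^ Suc k * a)
      = rot ((\<gamma> ^ k * a) * axis * qconj (\<gamma> ^ k * a))" for k a
    by (simp add: rot_def qconj_mult mult.assoc)
  have rot: "rot (x + y) = rot x + rot y" "rot (x - y) = rot x - rot y" "rot (- x) = - rot x"
    "rot (k *\<^sub>K x) = k *\<^sub>K rot x" "rot axis = axis" "rot tangent1 = tangent2"
    "rot tangent2 = - tangent1" for x y k
    by (simp_all add: rot_def algebra_simps gamma_axis_commute[unfolded mult.assoc]
        gamma_tangent1[unfolded mult.assoc] gamma_tangent2[unfolded mult.assoc])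
  show a0: "(\<gamma> ^ 0 * \<alpha>) * axis * qconj (\<gamma> ^ 0 * \<alpha>) = (1 + sqrt2) *\<^sub>K axis + tangent1"
    by (simp add: alpha_axis)
  show a1: "(\<gamma> ^ 1 * \<alpha>) * axis * qconj (\<gamma> ^ 1 * \<alpha>) = (1 + sqrt2) *\<^sub>K axis + tangent2"
    unfolding One_nat_def step a0 by (simp add: rot)
  show a2: "(\<gamma> ^ 2 * \<alpha>) * axis * qconj (\<gamma> ^ 2 * \<alpha>) = (1 + sqrt2) *\<^sub>K axis - tangent1"
    using step[of 1 \<alpha>] unfolding a1 by (simp add: rot numeral_2_eq_2)
  show "(\<gamma> ^ 3 * \<alpha>) * axis * qconj (\<gamma> ^ 3 * \<alpha>) = (1 + sqrt2) *\<^sub>K axis - tangent2"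
    using step[of 2 \<alpha>] unfolding a2 by (simp add: rot numeral_3_eq_3 numeral_2_eq_2)
  show b0: "(\<gamma> ^ 0 * qconj \<alpha>) * axis * qconj (\<gamma> ^ 0 * qconj \<alpha>)
      = (1 + sqrt2) *\<^sub>K axis + (sqrt2 / 2) *\<^sub>K (tangent1 - tangent2)"
    by (simp add: conj_alpha_axis)
  show b1: "(\<gamma> ^ 1 * qconj \<alpha>) * axis * qconj (\<gamma> ^ 1 * qconj \<alpha>)
      = (1 + sqrt2) *\<^sub>K axis + (sqrt2 / 2) *\<^sub>K (tangent2 + tangent1)"
    unfolding One_nat_def step b0 by (simp add: rot)
  show b2: "(\<gamma> ^ 2 * qconj \<alpha>) * axis * qconj (\<gamma> ^ 2 * qconj \<alpha>)
      = (1 + sqrt2) *\<^sub>K axis + (sqrt2 / 2) *\<^sub>K (tangent2 - tangent1)"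
    using step[of 1 "qconj \<alpha>"] unfolding b1 by (simp add: rot numeral_2_eq_2)
  show "(\<gamma> ^ 3 * qconj \<alpha>) * axis * qconj (\<gamma> ^ 3 * qconj \<alpha>)
      = (1 + sqrt2) *\<^sub>K axis + (sqrt2 / 2) *\<^sub>K (- tangent1 - tangent2)"
    using step[of 2 "qconj \<alpha>"] unfolding b2 by (simp add: rot numeral_3_eq_3 numeral_2_eq_2)
qed

text \<open>If no neighbour were closer, the tangential coordinates of \<open>g axis g\<^sup>-\<^sup>1\<close> would lie in an octagon of size
proportional to the height. Comparing \<open>octagon_bound\<close> with \<open>height_hyperboloid\<close> then bounds the height by the
hyperbolic cosine of the circumradius, about \<open>1.394\<close>, which is less than \<open>sqrt 2\<close>.\<close>

lemma height_descent:
  assumes n: "nrd g = 1" and f: "real_of_K (height g) \<ge> sqrt 2"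
  shows "\<exists>k. \<exists>a\<in>{\<alpha>, qconj \<alpha>}. real_of_K (height (qconj (\<gamma> ^ k * a) * g)) < real_of_K (height g)"
proof (rule ccontr)
  assume neg: "\<not> ?thesis"
  define P where "P = g * axis * qconj g"
  define f x y where "f = real_of_K (height g)" and "x = real_of_K (pairing tangent1 P)"
    and "y = real_of_K (pairing tangent2 P)"
  have hf: "pairing axis P = height g" by (simp add: height_def P_def)
  have le: "f \<le> real_of_K (pairing ((\<gamma> ^ k * \<alpha>) * axis * qconj (\<gamma> ^ k * \<alpha>)) P)"
    "f \<le> real_of_K (pairing ((\<gamma> ^ k * qconj \<alpha>) * axis * qconj (\<gamma> ^ k * qconj \<alpha>)) P)" for k
    using neg unfolding P_def f_def height_translate[symmetric] not_less[symmetric] by blast+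
  have half: "real_of_K (sqrt2 / 2) = sqrt 2 / 2" by simp
  have real_pairing: "real_of_K (pairing ((1 + sqrt2) *\<^sub>K axis + v) P) = (1 + sqrt 2) * f + real_of_K (pairing v P)"
    "real_of_K (pairing ((1 + sqrt2) *\<^sub>K axis - v) P) = (1 + sqrt 2) * f - real_of_K (pairing v P)"
    "real_of_K (pairing ((sqrt2 / 2) *\<^sub>K v) P) = sqrt 2 / 2 * real_of_K (pairing v P)" for v
    unfolding pairing_add pairing_diff pairing_scale hf real_of_K_simps half f_def by simp_all
  have A: "f \<le> (1 + sqrt 2) * f + x" "f \<le> (1 + sqrt 2) * f + y"
    "f \<le> (1 + sqrt 2) * f - x" "f \<le> (1 + sqrt 2) * f - y"
    using le(1)[of 0] le(1)[of 1] le(1)[of 2] le(1)[of 3]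
    unfolding neighbour_axes real_pairing x_def y_def .
  have B: "f \<le> (1 + sqrt 2) * f + sqrt 2 / 2 * (x - y)" "f \<le> (1 + sqrt 2) * f + sqrt 2 / 2 * (y + x)"
    "f \<le> (1 + sqrt 2) * f + sqrt 2 / 2 * (y - x)" "f \<le> (1 + sqrt 2) * f + sqrt 2 / 2 * (- x - y)"
    using le(2)[of 0] le(2)[of 1] le(2)[of 2] le(2)[of 3]
    unfolding neighbour_axes real_pairing
    unfolding pairing_add pairing_diff pairing_uminus real_of_K_simps x_def y_def .
  have B': "d \<le> 2 * f" if "f \<le> (1 + sqrt 2) * f + sqrt 2 / 2 * (- d)" for d
  proof -
    have "sqrt 2 * (d / 2) \<le> sqrt 2 * f" using that by (simp add: algebra_simps)
    then show ?thesis by simp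
  qed
  have "\<bar>x\<bar> \<le> sqrt 2 * f" "\<bar>y\<bar> \<le> sqrt 2 * f" using A by (simp_all add: algebra_simps abs_le_iff)
  moreover have "\<bar>x\<bar> + \<bar>y\<bar> \<le> 2 * f"
    using B'[of "y - x"] B'[of "x + y"] B'[of "x - y"] B'[of "- x - y"] B
    by (simp add: add.commute)
  moreover have f2: "f \<ge> sqrt 2" using f by (simp add: f_def)
  then have "f > 0" using real_sqrt_gt_zero[of 2] by linarith
  ultimately have "x\<^sup>2 + y\<^sup>2 \<le> (8 - 4 * sqrt 2) * f\<^sup>2" by (intro octagon_bound)
  moreover have "(2 + 2 * sqrt 2) * (f\<^sup>2 - 1) = x\<^sup>2 + y\<^sup>2"
    using arg_cong[OF height_hyperboloid[OF n], of real_of_K] by (simp add: f_def x_def y_def P_def)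
  ultimately have "(6 * sqrt 2 - 6) * f\<^sup>2 \<le> 2 + 2 * sqrt 2" by (simp add: algebra_simps)
  \<comment> \<open>The coefficient is \<open>(2 + 2 sqrt 2) - (8 - 4 sqrt 2)\<close>, and \<open>f\<^sup>2 \<ge> 2\<close>.\<close>
  moreover have "(6 * sqrt 2 - 6) * 2 \<le> (6 * sqrt 2 - 6) * f\<^sup>2"
    using f2 power_mono[of "sqrt 2" f 2] by (intro mult_left_mono) auto
  ultimately have "(6 * sqrt 2 - 6) * 2 \<le> 2 + 2 * sqrt 2" by (rule order_trans[rotated])
  then have "10 * sqrt 2 \<le> 14" by simp
  moreover have "sqrt 2 > 14 / 10" by (rule real_less_rsqrt) (simp add: power2_eq_square)
  ultimately show False by simp
qed

text \<open>The sum of the squares of the two embeddings of \<open>m + n sqrt 2\<close> is \<open>2 m\<^sup>2 + 4 n\<^sup>2\<close>.\<close>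

lemma O_K_small:
  assumes x: "x \<in> O_K" and r: "(real_of_K x)\<^sup>2 \<le> 2" and c: "(conj_of_K x)\<^sup>2 \<le> 2"
  shows "x \<in> {0, 1, - 1, sqrt2, - sqrt2}"
proof -
  obtain m n where mn: "x = of_int m + of_int n * sqrt2" using x by (auto simp: O_K_def)
  have "(real_of_K x)\<^sup>2 + (conj_of_K x)\<^sup>2 = 2 * (real_of_int m)\<^sup>2 + 4 * (real_of_int n)\<^sup>2"
    by (simp add: mn power2_eq_square algebra_simps)
  then have "real_of_int (m\<^sup>2 + 2 * n\<^sup>2) \<le> 2" using r c by simp
  then have le: "m\<^sup>2 + 2 * n\<^sup>2 \<le> 2" by linarith
  have "\<not> 4 \<le> m\<^sup>2" "\<not> 4 \<le> n\<^sup>2"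
    using le zero_le_power2[of m] zero_le_power2[of n] by linarith+
  then have "\<bar>m\<bar> < 2" "\<bar>n\<bar> < 2"
    using abs_le_square_iff[of 2 m] abs_le_square_iff[of 2 n] by simp_all
  then have "m = -1 \<or> m = 0 \<or> m = 1" "n = -1 \<or> n = 0 \<or> n = 1" by arith+
  then show ?thesis using le by (auto simp: mn)
qed

text \<open>Writing the height as \<open>m + n sqrt 2\<close>, the bounds at the two places leave no room: \<open>2 n sqrt 2\<close>, the
difference of the two embeddings, lies in \<open>[0, 1 + sqrt 2)\<close> and forces \<open>n = 0\<close>.\<close>

lemma height_less_sqrt2:
  assumes g: "g \<in> Q_B" "nrd g = 1" and f: "real_of_K (height g) < sqrt 2"
  shows "height g = 1"
proof -
  obtain m n where mn: "height g = of_int m + of_int n * sqrt2"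
    using height_O_K[OF g] by (auto simp: O_K_def)
  have 1: "m + n * sqrt 2 \<ge> 1" "m + n * sqrt 2 < sqrt 2"
    using height_ge_one[OF g(2)] f by (simp_all add: mn)
  have 2: "m - n * sqrt 2 \<le> 1" "m - n * sqrt 2 \<ge> - 1"
    using conj_height_bound[OF g(2)] by (simp_all add: mn abs_le_iff)
  have s: "sqrt 2 \<le> 3 / 2" by (rule real_le_lsqrt) (simp_all add: power2_eq_square)
  have p: "sqrt 2 > 1" by simp
  have "n * sqrt 2 \<ge> 0 * sqrt 2" "n * sqrt 2 < 1 * sqrt 2" using 1 2 s p by linarith+
  then have n: "n = 0" by (simp add: mult_less_cancel_right zero_le_mult_iff)
  then have "real_of_int m \<ge> 1" "real_of_int m < 2" using 1 s by auto
  then have "m = 1" by linarith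
  with n show ?thesis by (simp add: mn)
qed

lemma gamma_powers:
  "\<gamma>\<^sup>2 = lin (- 1) 0 0 (- sqrt2)" "\<gamma> ^ 3 = lin sqrt2 0 0 1" "\<gamma> ^ 4 = - 1"
proof -
  have g: "\<gamma> = lin 0 0 0 1" by (simp add: lin_def)
  show 2: "\<gamma>\<^sup>2 = lin (- 1) 0 0 (- sqrt2)"
    unfolding power2_eq_square g lin_mult by simp
  have "\<gamma> ^ 3 = \<gamma>\<^sup>2 * \<gamma>" by (simp add: power3_eq_cube power2_eq_square)
  also have "\<dots> = lin sqrt2 0 0 1" unfolding 2 unfolding g lin_mult by (simp add: sqrt2_squared)
  finally show 3: "\<gamma> ^ 3 = lin sqrt2 0 0 1" .
  have "\<gamma> ^ 4 = \<gamma> ^ 3 * \<gamma>" by (simp add: eval_nat_numeral mult.assoc)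
  also have "\<dots> = lin (- 1) 0 0 0" unfolding 3 unfolding g lin_mult by simp
  finally show "\<gamma> ^ 4 = - 1" by (simp add: lin_def)
qed

text \<open>Height \<open>1\<close> makes the part of \<open>g\<close> anticommuting with \<open>axis\<close> vanish, so \<open>g = a + d \<gamma>\<close> with integral \<open>a, d\<close>. Its
norm \<open>a\<^sup>2 - sqrt 2 a d + d\<^sup>2\<close> is a positive definite form at both real places, hence there are only
finitely many candidates: the eight elements \<open>\<gamma>\<^sup>k\<close>.\<close>

lemma height_one:
  assumes g: "g \<in> Q_B" "nrd g = 1" and h: "height g = 1"
  shows "\<exists>k. g = \<gamma> ^ k \<or> g = - (\<gamma> ^ k)"
proof -
  have "(real_of_K (co1 (g * tangent1)))\<^sup>2 + (real_of_K (co1 (g * tangent2)))\<^sup>2 = 0"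
    using arg_cong[OF height_minus_nrd[of g], of real_of_K] g h by simp
  then have "real_of_K (co1 (g * tangent1)) = real_of_K 0" "real_of_K (co1 (g * tangent2)) = real_of_K 0"
    by (simp_all add: sum_power2_eq_zero_iff)
  then have z: "co1 (g * tangent1) = 0" "co1 (g * tangent2) = 0"
    by (simp_all only: real_of_K_inject)
  obtain a b c d where gl: "g = lin a b c d" and O: "a \<in> O_K" "d \<in> O_K"
    using g unfolding Q_B_lin by blast
  have "co1 (g * tangent1) = (1 + sqrt2) * b + c" "co1 (g * tangent2) = - (b + (1 + sqrt2) * c)"
    unfolding gl lin_coords tangent1_def tangent2_def times_D_B_def
    by (simp_all add: field_simps sqrt2_squared sqrt2_sqrt2)
  then have t1: "(1 + sqrt2) * b + c = 0" and t2: "b + (1 + sqrt2) * c = 0"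
    using z by (metis, metis neg_equal_0_iff_equal)
  have c: "c = - ((1 + sqrt2) * b)" using t1 by (simp add: add_eq_0_iff)
  have "(2 + 2 * sqrt2) * b = - (b + (1 + sqrt2) * c)"
    unfolding c by (simp add: algebra_simps sqrt2_sqrt2)
  then have "(2 + 2 * sqrt2) * b = 0" unfolding t2 by simp
  moreover have "real_of_K (2 + 2 * sqrt2) > real_of_K 0" by (simp add: add_pos_pos)
  then have "2 + 2 * sqrt2 \<noteq> 0" by (metis less_irrefl)
  ultimately have "b = 0 \<and> c = 0" using c by simp
  then have gl: "g = a *\<^sub>K 1 + d *\<^sub>K \<gamma>" by (simp add: gl lin_def)
  have "nrd g = a\<^sup>2 - sqrt2 * a * d + d\<^sup>2"
    unfolding gl gamma_coords
    by (simp add: nrd_def scale_def plus_D_B_def one_D_B_def power2_eq_square field_simps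
      sqrt2_squared sqrt2_sqrt2)
  then have q: "a\<^sup>2 - sqrt2 * a * d + d\<^sup>2 = 1" using g(2) by simp
  have bound: "x\<^sup>2 \<le> 2 \<and> y\<^sup>2 \<le> 2" if "x\<^sup>2 - s * x * y + y\<^sup>2 = 1" "s\<^sup>2 = 2" for s x y :: real
  proof -
    have "(2 * x - s * y)\<^sup>2 = 4 * (x\<^sup>2 - s * x * y + y\<^sup>2) - (4 - s\<^sup>2) * y\<^sup>2"
      "(2 * y - s * x)\<^sup>2 = 4 * (x\<^sup>2 - s * x * y + y\<^sup>2) - (4 - s\<^sup>2) * x\<^sup>2"
      by (simp_all add: power2_eq_square algebra_simps)
    then have "(2 * x - s * y)\<^sup>2 = 4 - 2 * y\<^sup>2" "(2 * y - s * x)\<^sup>2 = 4 - 2 * x\<^sup>2"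
      unfolding that by simp_all
    then show ?thesis using zero_le_power2[of "2 * x - s * y"] zero_le_power2[of "2 * y - s * x"] by linarith
  qed
  have "(real_of_K a)\<^sup>2 - sqrt 2 * real_of_K a * real_of_K d + (real_of_K d)\<^sup>2 = 1"
    "(conj_of_K a)\<^sup>2 - (- sqrt 2) * conj_of_K a * conj_of_K d + (conj_of_K d)\<^sup>2 = 1"
    using arg_cong[OF q, of real_of_K] arg_cong[OF q, of conj_of_K] by simp_all
  from bound[OF this(1)] bound[OF this(2)] O_K_small O
  have a: "a \<in> {0, 1, - 1, sqrt2, - sqrt2}" by simp
  have "(a, d) \<in> {(1, 0), (-1, 0), (0, 1), (0, -1), (1, sqrt2), (-1, - sqrt2), (sqrt2, 1), (- sqrt2, -1)}"
  proof -
    consider "a = 0" | "a = 1" | "a = - 1" | "a = sqrt2" | "a = - sqrt2" using a by blast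
    then show ?thesis
    proof cases
      case 1
      then have "d\<^sup>2 = 1" using q by simp
      with 1 show ?thesis by (auto simp: power2_eq_1_iff)
    next
      case 2
      then have "d * (d - sqrt2) = 0" using q by (simp add: power2_eq_square algebra_simps)
      with 2 show ?thesis by auto
    next
      case 3
      then have "d * (d + sqrt2) = 0" using q by (simp add: power2_eq_square algebra_simps)
      with 3 show ?thesis by (auto simp: add_eq_0_iff2)
    next
      case 4
      then have "(d - 1)\<^sup>2 = 0" using q by (simp add: power2_eq_square algebra_simps sqrt2_squared sqrt2_sqrt2)
      with 4 show ?thesis by simp
    next
      case 5
      then have "(d + 1)\<^sup>2 = 0" using q by (simp add: power2_eq_square algebra_simps sqrt2_squared sqrt2_sqrt2)
      with 5 show ?thesis by (simp add: add_eq_0_iff2)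
    qed
  qed
  then have "g \<in> {\<gamma> ^ 0, - (\<gamma> ^ 0), \<gamma> ^ 1, - (\<gamma> ^ 1), - (\<gamma> ^ 2), \<gamma> ^ 2, \<gamma> ^ 3, - (\<gamma> ^ 3)}"
    unfolding gamma_powers by (auto simp: gl lin_def)
  then show ?thesis by blast
qed

text \<open>Among numbers \<open>m + n sqrt 2 \<ge> 1\<close> whose conjugate is bounded by \<open>1\<close>, both coordinates are monotone in the
value, so \<open>m + n\<close> is a natural number that drops with every reduction of the height.\<close>

lemma descent_measure:
  fixes m n m' n' :: int
  assumes "m + n * sqrt 2 < m' + n' * sqrt (2::real)"
    and "1 \<le> m + n * sqrt 2" "1 \<le> m' + n' * sqrt 2" and "\<bar>m - n * sqrt 2\<bar> \<le> 1" "\<bar>m' - n' * sqrt 2\<bar> \<le> 1"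
  shows "0 \<le> m + n" "m + n < m' + n'"
proof -
  have s: "sqrt 2 > (1::real)" by simp
  have b: "- 1 \<le> m - n * sqrt 2" "m - n * sqrt 2 \<le> 1" "- 1 \<le> m' - n' * sqrt 2" "m' - n' * sqrt 2 \<le> 1"
    using assms(4,5) by (simp_all add: abs_le_iff)
  have "0 \<le> n * sqrt 2" "0 \<le> real_of_int m" using assms(2) b by linarith+
  then show "0 \<le> m + n" by (simp add: zero_le_mult_iff)
  have "n * sqrt 2 - n' * sqrt 2 < sqrt 2" using assms(1) b s by linarith
  then have "(n - n') * sqrt 2 < 1 * sqrt 2" by (simp add: algebra_simps)
  then have "real_of_int (n - n') < 1" unfolding mult_less_cancel_right by simp
  then have n: "n \<le> n'" by simp
  have "real_of_int m - m' < 1" using assms(1) b by linarith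
  then have m: "m \<le> m'" by linarith
  have "\<not> (m = m' \<and> n = n')" using assms(1) by auto
  with m n show "m + n < m' + n'" by linarith
qed

text \<open>Closure under \<open>\<alpha>\<close>, \<open>\<beta>\<close> and negation is enough: \<open>\<alpha>\<^sup>3 = -1\<close>, so inverses cost only a sign.\<close>

theorem Q_B1_generated:
  assumes g: "g \<in> Q_B" "nrd g = 1"
    and one: "1 \<in> S" and al: "\<And>x. x \<in> S \<Longrightarrow> \<alpha> * x \<in> S" and be: "\<And>x. x \<in> S \<Longrightarrow> \<beta> * x \<in> S"
    and neg: "\<And>x. x \<in> S \<Longrightarrow> - x \<in> S"
  shows "g \<in> S"
proof -
  have ga: "\<gamma> * x \<in> S" if "x \<in> S" for x using al be that by (simp add: \<gamma>_def mult.assoc)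
  have gap: "\<gamma> ^ k * x \<in> S" if "x \<in> S" for x k
    by (induction k) (simp_all add: that ga mult.assoc)
  have "qconj \<alpha> = - (\<alpha> * \<alpha>)"
    by (simp add: alpha_coords qconj_def times_D_B_def uminus_D_B_def)
  then have alc: "qconj \<alpha> * x \<in> S" if "x \<in> S" for x
    using neg al that by (simp add: mult.assoc)
  have "\<forall>g. g \<in> Q_B \<longrightarrow> nrd g = 1 \<longrightarrow> height g = of_int m + of_int n * sqrt2 \<longrightarrow> g \<in> S" for m n
  proof (induction "nat (m + n)" arbitrary: m n rule: less_induct)
    case less
    show ?case
    proof (intro allI impI)
      fix g assume g: "g \<in> Q_B" "nrd g = 1" and h: "height g = of_int m + of_int n * sqrt2"
      show "g \<in> S"
      proof (cases "real_of_K (height g) < sqrt 2")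
        case True
        then obtain k where "g = \<gamma> ^ k \<or> g = - (\<gamma> ^ k)"
          using height_less_sqrt2 height_one g by blast
        then show ?thesis using gap[OF one, of k] neg by auto
      next
        case False
        then obtain k a where a: "a \<in> {\<alpha>, qconj \<alpha>}"
          and lt: "real_of_K (height (qconj (\<gamma> ^ k * a) * g)) < real_of_K (height g)"
          using height_descent[OF g(2)] unfolding not_less by blast
        define s where "s = \<gamma> ^ k * a"
        have "nrd (\<gamma> ^ k) = 1" "\<gamma> ^ k \<in> Q_B"
          by (induction k) (simp_all add: nrd_one one_Q_B nrd_mult nrd_gamma Q_B_closed gamma_Q_B)
        then have s: "nrd s = 1" "s \<in> Q_B"
          using a by (auto simp: s_def nrd_mult nrd_alpha Q_B_closed qconj_Q_B alpha_Q_B)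
        define g' where "g' = qconj s * g"
        have g': "g' \<in> Q_B" "nrd g' = 1" using s g by (simp_all add: g'_def Q_B_closed qconj_Q_B nrd_mult)
        obtain m' n' where h': "height g' = of_int m' + of_int n' * sqrt2"
          using height_O_K[OF g'] by (auto simp: O_K_def)
        have "m' + n' * sqrt 2 < m + n * sqrt 2"
          using lt unfolding s_def[symmetric] g'_def[symmetric] h h' by simp
        moreover have "1 \<le> m' + n' * sqrt 2" "1 \<le> m + n * sqrt 2"
          using height_ge_one[OF g(2)] height_ge_one[OF g'(2)] unfolding h h' by simp_all
        moreover have "\<bar>m' - n' * sqrt 2\<bar> \<le> 1" "\<bar>m - n * sqrt 2\<bar> \<le> 1"
          using conj_height_bound[OF g(2)] conj_height_bound[OF g'(2)] unfolding h h' by simp_all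
        ultimately have "0 \<le> m' + n'" "m' + n' < m + n"
          by (rule descent_measure)+
        then have "nat (m' + n') < nat (m + n)" by linarith
        then have "g' \<in> S" using less g' h' by blast
        then have "a * g' \<in> S" using a alc al by blast
        then have "s * g' \<in> S" using gap by (simp add: s_def mult.assoc)
        then show ?thesis by (simp add: g'_def nrd_one_inverse[OF s(1)])
      qed
    qed
  qed
  moreover obtain m n where "height g = of_int m + of_int n * sqrt2"
    using height_O_K[OF g] by (auto simp: O_K_def)
  ultimately show ?thesis using g by blast
qed

section \<open>Normal subgroups containing minus one\<close>

lemma carrier_Q_B1: "x \<in> carrier Q_B1 \<longleftrightarrow> x \<in> Q_B \<and> nrd x = 1"
  by (simp add: Q_B1_def)

lemma Q_B1_simps [simp]: "x \<otimes>\<^bsub>Q_B1\<^esub> y = x * y" "\<one>\<^bsub>Q_B1\<^esub> = 1"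
  by (simp_all add: Q_B1_def)

lemma uminus_Q_B: "x \<in> Q_B \<Longrightarrow> - x \<in> Q_B"
  by (rule Q_B_closed(3))

lemma Q_B1_closed [simp, intro]:
  "1 \<in> carrier Q_B1" "\<alpha> \<in> carrier Q_B1" "\<beta> \<in> carrier Q_B1" "\<gamma> \<in> carrier Q_B1" "\<delta> \<in> carrier Q_B1"
  "x \<in> carrier Q_B1 \<Longrightarrow> - x \<in> carrier Q_B1"
  "x \<in> carrier Q_B1 \<Longrightarrow> qconj x \<in> carrier Q_B1"
  "x \<in> carrier Q_B1 \<Longrightarrow> y \<in> carrier Q_B1 \<Longrightarrow> x * y \<in> carrier Q_B1"
  by (simp_all add: carrier_Q_B1 one_Q_B nrd_one alpha_Q_B nrd_alpha beta_Q_B nrd_beta gamma_Q_B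
      nrd_gamma delta_Q_B nrd_delta Q_B_closed(2) uminus_Q_B nrd_minus qconj_Q_B nrd_mult)

lemma Q_B1_power [simp, intro]: "x \<in> carrier Q_B1 \<Longrightarrow> x ^ n \<in> carrier Q_B1"
  by (induction n) auto

lemma Q_B1_inverse:
  assumes "x \<in> carrier Q_B1"
  shows "x * qconj x = 1" "qconj x * x = 1" "x * (qconj x * y) = y" "qconj x * (x * y) = y"
  using assms nrd_one_inverse by (simp_all add: carrier_Q_B1)

lemma inv_Q_B1: "x \<in> carrier Q_B1 \<Longrightarrow> inv\<^bsub>Q_B1\<^esub> x = qconj x"
  using group.inv_equality[OF Q_B1_group, of "qconj x" x] by (simp add: Q_B1_inverse)

text \<open>Normal subgroups of \<open>Q_B1 / {1, -1}\<close> correspond to the normal subgroups of \<open>Q_B1\<close> that contain \<open>-1\<close>. Working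
with the latter, all computations take place in the quaternion algebra.\<close>

definition signed_normal :: "D_B set \<Rightarrow> bool"
  where "signed_normal S \<longleftrightarrow> S \<lhd> Q_B1 \<and> - 1 \<in> S"

lemma signed_normalI:
  assumes "S \<subseteq> carrier Q_B1" "- 1 \<in> S" "\<And>x y. x \<in> S \<Longrightarrow> y \<in> S \<Longrightarrow> x * y \<in> S"
    "\<And>x. x \<in> S \<Longrightarrow> qconj x \<in> S" "\<And>g x. g \<in> carrier Q_B1 \<Longrightarrow> x \<in> S \<Longrightarrow> g * x * qconj g \<in> S"
  shows "signed_normal S"
proof -
  interpret group Q_B1 by (rule Q_B1_group)
  have "subgroup S Q_B1"
    by (rule subgroupI) (use assms in \<open>auto simp: inv_Q_B1 subset_iff\<close>)
  then show ?thesis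
    using assms by (auto simp: signed_normal_def normal_inv_iff inv_Q_B1)
qed

lemma signed_normalD:
  assumes "signed_normal S"
  shows "x \<in> S \<Longrightarrow> x \<in> carrier Q_B1" "1 \<in> S" "x \<in> S \<Longrightarrow> y \<in> S \<Longrightarrow> x * y \<in> S"
    "x \<in> S \<Longrightarrow> - x \<in> S" "x \<in> S \<Longrightarrow> qconj x \<in> S"
    "g \<in> carrier Q_B1 \<Longrightarrow> x \<in> S \<Longrightarrow> g * x * qconj g \<in> S"
proof -
  interpret normal S Q_B1 using assms by (simp add: signed_normal_def)
  show c: "x \<in> S \<Longrightarrow> x \<in> carrier Q_B1" for x by (rule mem_carrier)
  show "1 \<in> S" using subgroup.one_closed[OF subgroup_axioms] by simp
  show m: "x \<in> S \<Longrightarrow> y \<in> S \<Longrightarrow> x * y \<in> S" for x y using subgroup.m_closed[OF subgroup_axioms, of x y] by simp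
  show "x \<in> S \<Longrightarrow> - x \<in> S" using m[of "- 1" x] assms by (simp add: signed_normal_def)
  show "x \<in> S \<Longrightarrow> qconj x \<in> S" using subgroup.m_inv_closed[OF subgroup_axioms, of x] by (simp add: inv_Q_B1 c)
  show "g \<in> carrier Q_B1 \<Longrightarrow> x \<in> S \<Longrightarrow> g * x * qconj g \<in> S"
    using inv_op_closed2[of g x] by (simp add: inv_Q_B1)
qed

lemma proj_eq: "proj x = {x, - x}"
  by (auto simp: proj_def r_coset_def)

lemma proj_hom: "group_hom Q_B1 PQ_B1 proj"
  unfolding group_hom_def group_hom_axioms_def proj_def
  using Q_B1_group PQ_B1_group normal.r_coset_hom_Mod[OF pm1_normal] by (simp add: PQ_B1_def)

lemma proj_carrier: "proj ` carrier Q_B1 = carrier PQ_B1"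
  by (auto simp: proj_def PQ_B1_def carrier_FactGroup)

lemma proj_image_iff: "signed_normal S \<Longrightarrow> proj x \<in> proj ` S \<longleftrightarrow> x \<in> S"
  using signed_normalD(4)[of S] by (auto simp: proj_eq doubleton_eq_iff)

lemma proj_image_normal: "signed_normal S \<Longrightarrow> proj ` S \<lhd> PQ_B1"
  using normal.surj_hom_normal_subgroup[OF _ proj_hom proj_carrier] by (simp add: signed_normal_def)

lemma proj_preimage_normal:
  assumes "N \<lhd> PQ_B1"
  shows "signed_normal {x \<in> carrier Q_B1. proj x \<in> N}"
proof -
  interpret hom: group_hom Q_B1 PQ_B1 proj by (rule proj_hom)
  interpret normal N PQ_B1 by (rule assms)
  have m: "proj (x * y) = proj x \<otimes>\<^bsub>PQ_B1\<^esub> proj y" if "x \<in> carrier Q_B1" "y \<in> carrier Q_B1" for x y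
    using hom.hom_mult[OF that] by simp
  have i: "proj (qconj x) = inv\<^bsub>PQ_B1\<^esub> proj x" if "x \<in> carrier Q_B1" for x
    using hom.hom_inv[OF that] that by (simp add: inv_Q_B1)
  have "proj (- 1) = proj 1" by (auto simp: proj_eq)
  then have "proj (- 1) \<in> N"
    using hom.hom_one subgroup.one_closed[OF subgroup_axioms] by simp
  then show ?thesis
    by (intro signed_normalI)
      (simp_all add: m i inv_op_closed2 subgroup.m_closed[OF subgroup_axioms]
        subgroup.m_inv_closed[OF subgroup_axioms] subset_iff)
qed

lemma proj_image_psubset:
  assumes "signed_normal S" "signed_normal T" "S \<subset> T"
  shows "proj ` S \<subset> proj ` T"
proof
  show "proj ` S \<subseteq> proj ` T" using assms(3) by blast
  obtain x where "x \<in> T" "x \<notin> S" using assms(3) by blast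
  then have "proj x \<in> proj ` T" "proj x \<notin> proj ` S" using assms(1) proj_image_iff by simp_all
  then show "proj ` S \<noteq> proj ` T" by (metis)
qed

section \<open>The Bolza group in terms of the norm one group\<close>

definition bolza_relator :: D_B where "bolza_relator = (\<alpha> * \<beta>)\<^sup>2 * (\<alpha>\<^sup>2 * \<beta>\<^sup>2)\<^sup>2"

definition Bolza_lift :: "D_B set"
  where "Bolza_lift = {x \<in> carrier Q_B1. proj x \<in> Bolza_group}"

lemma Bolza_group_iff: "y \<in> Bolza_group \<longleftrightarrow> (\<forall>N. N \<lhd> PQ_B1 \<longrightarrow> proj bolza_relator \<in> N \<longrightarrow> y \<in> N)"
  by (auto simp: Bolza_group_def hull_def bolza_relator_def)

lemma bolza_relator_Q_B1: "bolza_relator \<in> carrier Q_B1"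
  by (simp add: bolza_relator_def Q_B1_closed Q_B1_power)

lemma bolza_relator_lift: "bolza_relator \<in> Bolza_lift"
  by (simp add: Bolza_lift_def bolza_relator_Q_B1 Bolza_group_iff)

lemma Bolza_lift_least:
  assumes "signed_normal S" "bolza_relator \<in> S"
  shows "Bolza_lift \<subseteq> S"
proof
  fix x assume "x \<in> Bolza_lift"
  then have "proj x \<in> Bolza_group" by (simp add: Bolza_lift_def)
  then have "proj x \<in> proj ` S"
    using proj_image_normal[OF assms(1)] assms(2) unfolding Bolza_group_iff by blast
  then show "x \<in> S" by (simp only: proj_image_iff[OF assms(1)])
qed

text \<open>The preimage of the normal closure is the least normal subgroup that contains \<open>-1\<close> and the relator.\<close>

lemma Bolza_lift_iff:
  "x \<in> Bolza_lift \<longleftrightarrow> x \<in> carrier Q_B1 \<and> (\<forall>S. signed_normal S \<longrightarrow> bolza_relator \<in> S \<longrightarrow> x \<in> S)"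
proof
  assume "x \<in> Bolza_lift"
  moreover have "x \<in> carrier Q_B1" using \<open>x \<in> Bolza_lift\<close> by (simp add: Bolza_lift_def)
  ultimately show "x \<in> carrier Q_B1 \<and> (\<forall>S. signed_normal S \<longrightarrow> bolza_relator \<in> S \<longrightarrow> x \<in> S)"
    using Bolza_lift_least by blast
next
  assume x: "x \<in> carrier Q_B1 \<and> (\<forall>S. signed_normal S \<longrightarrow> bolza_relator \<in> S \<longrightarrow> x \<in> S)"
  have "proj x \<in> N" if "N \<lhd> PQ_B1" "proj bolza_relator \<in> N" for N
    using x proj_preimage_normal[OF that(1)] that(2) bolza_relator_Q_B1 by blast
  with x show "x \<in> Bolza_lift" by (simp add: Bolza_lift_def Bolza_group_iff)
qed

lemma signed_normal_Bolza_lift: "signed_normal Bolza_lift"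
proof (rule signed_normalI)
  show "- 1 \<in> Bolza_lift"
    unfolding Bolza_lift_iff using signed_normalD(2,4) by blast
  show "x * y \<in> Bolza_lift" if "x \<in> Bolza_lift" "y \<in> Bolza_lift" for x y
    using that signed_normalD(3) unfolding Bolza_lift_iff by blast
  show "qconj x \<in> Bolza_lift" if "x \<in> Bolza_lift" for x
    using that signed_normalD(5) unfolding Bolza_lift_iff by blast
  show "g * x * qconj g \<in> Bolza_lift" if "g \<in> carrier Q_B1" "x \<in> Bolza_lift" for g x
    using that signed_normalD(6) unfolding Bolza_lift_iff by blast
qed (simp add: Bolza_lift_def)

lemma Bolza_group_lift: "Bolza_group = proj ` Bolza_lift"
proof -
  have "signed_normal (carrier Q_B1)" by (rule signed_normalI) simp_all
  then have "carrier PQ_B1 \<lhd> PQ_B1" using proj_image_normal proj_carrier by metis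
  moreover have "proj bolza_relator \<in> carrier PQ_B1"
    using bolza_relator_Q_B1 proj_carrier by blast
  ultimately have "Bolza_group \<subseteq> carrier PQ_B1" using Bolza_group_iff by blast
  then show ?thesis unfolding Bolza_lift_def proj_carrier[symmetric] by blast
qed

section \<open>Congruence subgroups\<close>

lemma order_idealI:
  assumes "J \<subseteq> Q_B" "0 \<in> J" "\<And>x y. x \<in> J \<Longrightarrow> y \<in> J \<Longrightarrow> x + y \<in> J"
    "\<And>q x. q \<in> Q_B \<Longrightarrow> x \<in> J \<Longrightarrow> q * x \<in> J" "\<And>q x. q \<in> Q_B \<Longrightarrow> x \<in> J \<Longrightarrow> x * q \<in> J"
  shows "ideal J Q_B_ring"
proof (rule idealI[OF Q_B_ring])
  interpret ring Q_B_ring by (rule Q_B_ring)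
  have "- 1 \<in> Q_B" using Q_B_closed(3) one_Q_B by blast
  then have neg: "- x \<in> J" if "x \<in> J" for x using assms(4)[of "- 1" x] that by simp
  have inv: "inv\<^bsub>add_monoid Q_B_ring\<^esub> x = - x" if "x \<in> J" for x
    by (rule group.inv_equality[OF a_group])
      (use that assms(1) in \<open>auto simp: Q_B_ring_def Q_B_closed\<close>)
  show "subgroup J (add_monoid Q_B_ring)"
    by (rule group.subgroupI[OF a_group]) (use assms neg inv in \<open>auto simp: Q_B_ring_def\<close>)
qed (use assms in \<open>auto simp: Q_B_ring_def\<close>)

lemma order_idealD:
  assumes "ideal J Q_B_ring"
  shows "x \<in> J \<Longrightarrow> x \<in> Q_B" "0 \<in> J" "x \<in> J \<Longrightarrow> y \<in> J \<Longrightarrow> x + y \<in> J"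
    "q \<in> Q_B \<Longrightarrow> x \<in> J \<Longrightarrow> q * x \<in> J" "q \<in> Q_B \<Longrightarrow> x \<in> J \<Longrightarrow> x * q \<in> J" "x \<in> J \<Longrightarrow> - x \<in> J"
proof -
  interpret ideal J Q_B_ring by (rule assms)
  show "x \<in> J \<Longrightarrow> x \<in> Q_B" using a_Hcarr by (simp add: Q_B_ring_def)
  show "0 \<in> J" using additive_subgroup.zero_closed[OF ideal.axioms(1)[OF assms]] by (simp add: Q_B_ring_def)
  show "x \<in> J \<Longrightarrow> y \<in> J \<Longrightarrow> x + y \<in> J" using additive_subgroup.a_closed[OF ideal.axioms(1)[OF assms]] by (simp add: Q_B_ring_def)
  show l: "q \<in> Q_B \<Longrightarrow> x \<in> J \<Longrightarrow> q * x \<in> J" for q using I_l_closed by (simp add: Q_B_ring_def)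
  show "q \<in> Q_B \<Longrightarrow> x \<in> J \<Longrightarrow> x * q \<in> J" using I_r_closed by (simp add: Q_B_ring_def)
  show "x \<in> J \<Longrightarrow> - x \<in> J" using l[of "- 1"] Q_B_closed(3)[OF one_Q_B one_Q_B] by simp
qed

definition congruence_subgroup :: "D_B set \<Rightarrow> D_B set"
  where "congruence_subgroup J = {x \<in> carrier Q_B1. x - 1 \<in> J}"

lemma Q_B1_cong_principal:
  "Q_B1_cong (principal_OK c) = congruence_subgroup (ideal_times_Q_B (principal_OK c))"
  by (auto simp: congruence_subgroup_def mem_Q_B1_cong carrier_Q_B1 mem_principal)

lemma signed_normal_congruence_subgroup:
  assumes J: "ideal J Q_B_ring" and two: "2 \<in> J"
  shows "signed_normal (congruence_subgroup J)"
proof (rule signed_normalI)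
  note I = order_idealD[OF J]
  show "- 1 \<in> congruence_subgroup J" using I(6)[OF two] by (simp add: congruence_subgroup_def)
  show "x * y \<in> congruence_subgroup J" if "x \<in> congruence_subgroup J" "y \<in> congruence_subgroup J" for x y
  proof -
    have xy: "x \<in> carrier Q_B1" "x - 1 \<in> J" "y \<in> carrier Q_B1" "y - 1 \<in> J"
      using that by (simp_all add: congruence_subgroup_def)
    have "x * y - 1 = x * (y - 1) + (x - 1)" by (simp add: algebra_simps)
    also have "\<dots> \<in> J" using xy I(3,4) by (simp add: carrier_Q_B1)
    finally show ?thesis using xy by (simp add: congruence_subgroup_def)
  qed
  show "qconj x \<in> congruence_subgroup J" if "x \<in> congruence_subgroup J" for x
  proof -
    have x: "x \<in> carrier Q_B1" "x - 1 \<in> J" using that by (simp_all add: congruence_subgroup_def)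
    have "qconj x - 1 = - (qconj x * (x - 1))" using Q_B1_inverse[OF x(1)] by (simp add: algebra_simps)
    then show ?thesis
      using x I(4,6) qconj_Q_B by (simp add: congruence_subgroup_def carrier_Q_B1)
  qed
  show "g * x * qconj g \<in> congruence_subgroup J" if g: "g \<in> carrier Q_B1" and "x \<in> congruence_subgroup J" for g x
  proof -
    have x: "x \<in> carrier Q_B1" "x - 1 \<in> J" using that by (simp_all add: congruence_subgroup_def)
    have "g * x * qconj g - 1 = g * (x - 1) * qconj g"
      using Q_B1_inverse[OF g] by (simp add: algebra_simps)
    moreover have "g * (x - 1) * qconj g \<in> J"
      using x g I(4,5) qconj_Q_B by (simp add: carrier_Q_B1)
    ultimately show ?thesis using x g by (simp add: congruence_subgroup_def)
  qed
qed (simp add: congruence_subgroup_def)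

text \<open>A generator of the two-sided prime ideal above \<open>sqrt 2\<close>. Since \<open>\<pi>\<^sup>2 = - (2 + sqrt 2) \<gamma>\<close>, it acts on the hyperbolic
plane as a square root of \<open>\<gamma>\<close>, an eighth of a turn that interchanges the two classes of order-three
points.\<close>

definition \<pi> :: D_B where "\<pi> = 1 - \<gamma>"

lemma alpha_lin: "\<alpha> = lin 0 1 0 0" and beta_lin: "\<beta> = lin 0 0 1 0" and gamma_lin: "\<gamma> = lin 0 0 0 1"
  and one_lin: "1 = lin 1 0 0 0" and delta_lin: "\<delta> = lin (- 1 - sqrt2) 1 1 (- 1)"
  and pi_lin: "\<pi> = lin 1 0 0 (- 1)"
proof -
  show 1: "\<alpha> = lin 0 1 0 0" "\<beta> = lin 0 0 1 0" "\<gamma> = lin 0 0 0 1" "1 = lin 1 0 0 0"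
    by (simp_all add: lin_def)
  show "\<delta> = lin (- 1 - sqrt2) 1 1 (- 1)"
    unfolding \<delta>_def 1 lin_mult by simp
  show "\<pi> = lin 1 0 0 (- 1)"
    by (simp add: \<pi>_def lin_def)
qed

lemma pi_Q_B: "\<pi> \<in> Q_B"
  by (simp add: \<pi>_def Q_B_closed one_Q_B gamma_Q_B)

lemma nrd_pi: "nrd \<pi> = 2 + sqrt2"
  unfolding pi_lin lin_coords
  by (simp add: nrd_def power2_eq_square field_simps sqrt2_squared sqrt2_sqrt2)

lemma alpha_pi: "\<alpha> * \<pi> = \<pi> * \<beta>"
  unfolding alpha_lin pi_lin beta_lin lin_mult by (simp add: algebra_simps)

lemma beta_pi: "\<beta> * \<pi> = \<pi> * (qconj \<beta> * \<alpha> * \<beta>)"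
proof -
  have "qconj \<beta> = lin 1 0 (- 1) 0"
    unfolding lin_coords by (simp add: beta_coords qconj_def field_simps)
  then show ?thesis
    by (simp add: alpha_lin pi_lin beta_lin lin_mult sqrt2_squared algebra_simps)
qed

text \<open>Conjugation by \<open>\<pi>\<close> maps the generators of the order into the order, hence the whole order; this makes the
right ideal \<open>\<pi> Q_B\<close> two-sided.\<close>

lemma Q_B_pi: "q \<in> Q_B \<Longrightarrow> \<exists>q'\<in>Q_B. q * \<pi> = \<pi> * q'"
proof -
  let ?S = "{q. \<exists>q'\<in>Q_B. q * \<pi> = \<pi> * q'}"
  have "OK_subalgebra ?S"
    unfolding OK_subalgebra_def
  proof (intro conjI ballI)
    show "1 \<in> ?S" using one_Q_B by force
    show "a *\<^sub>K x \<in> ?S" if "a \<in> O_K" "x \<in> ?S" for a x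
    proof -
      obtain x' where x: "x' \<in> Q_B" "x * \<pi> = \<pi> * x'" using \<open>x \<in> ?S\<close> by blast
      have "(a *\<^sub>K x) * \<pi> = \<pi> * (a *\<^sub>K x')" by (simp add: x)
      then show ?thesis using scale_Q_B[OF \<open>a \<in> O_K\<close> x(1)] by blast
    qed
    fix x y assume "x \<in> ?S" "y \<in> ?S"
    then obtain x' y' where x: "x' \<in> Q_B" "x * \<pi> = \<pi> * x'" and y: "y' \<in> Q_B" "y * \<pi> = \<pi> * y'"
      by blast
    have "(x + y) * \<pi> = \<pi> * (x' + y')" using x y by (simp add: algebra_simps)
    then show "x + y \<in> ?S" using x y Q_B_closed(1) by blast
    have "(x * y) * \<pi> = (x * \<pi>) * y'" by (simp only: y mult.assoc)
    also have "\<dots> = \<pi> * (x' * y')" by (simp only: x mult.assoc)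
    finally have "(x * y) * \<pi> = \<pi> * (x' * y')" .
    then show "x * y \<in> ?S" using x y Q_B_closed(2) by blast
  qed
  moreover have "\<alpha> \<in> ?S" using alpha_pi beta_Q_B by blast
  moreover have "qconj \<beta> * \<alpha> * \<beta> \<in> Q_B"
    by (intro Q_B_closed(2) qconj_Q_B alpha_Q_B beta_Q_B)
  then have "\<beta> \<in> ?S" using beta_pi by blast
  ultimately have "Q_B \<subseteq> ?S" unfolding Q_B_def by (intro hull_minimal) auto
  then show "q \<in> Q_B \<Longrightarrow> \<exists>q'\<in>Q_B. q * \<pi> = \<pi> * q'" by blast
qed

text \<open>The ideal \<open>P\<^sup>3\<close> for \<open>P = \<pi> Q_B\<close>, as \<open>P\<^sup>2 = sqrt 2 Q_B\<close>.\<close>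

definition prime_cubed :: "D_B set"
  where "prime_cubed = {sqrt2 *\<^sub>K (\<pi> * y) | y. y \<in> Q_B}"

lemma ideal_prime_cubed: "ideal prime_cubed Q_B_ring"
proof (rule order_idealI)
  show "prime_cubed \<subseteq> Q_B"
    by (auto simp: prime_cubed_def intro!: scale_Q_B sqrt2_O_K Q_B_closed pi_Q_B)
  have "0 = sqrt2 *\<^sub>K (\<pi> * 0)" by simp
  then show "0 \<in> prime_cubed" unfolding prime_cubed_def using zero_Q_B by blast
  fix x assume "x \<in> prime_cubed"
  then obtain u where u: "u \<in> Q_B" "x = sqrt2 *\<^sub>K (\<pi> * u)" by (auto simp: prime_cubed_def)
  show "x + y \<in> prime_cubed" if "y \<in> prime_cubed" for y
  proof -
    obtain v where v: "v \<in> Q_B" "y = sqrt2 *\<^sub>K (\<pi> * v)" using \<open>y \<in> prime_cubed\<close> by (auto simp: prime_cubed_def)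
    have "x + y = sqrt2 *\<^sub>K (\<pi> * (u + v))" by (simp add: u v distrib_left D_B.scale_right_distrib)
    then show ?thesis unfolding prime_cubed_def using Q_B_closed(1)[OF u(1) v(1)] by blast
  qed
  fix q assume q: "q \<in> Q_B"
  have "x * q = sqrt2 *\<^sub>K (\<pi> * (u * q))" by (simp add: u mult.assoc)
  then show "x * q \<in> prime_cubed" unfolding prime_cubed_def using Q_B_closed(2)[OF u(1) q] by blast
  obtain q' where q': "q' \<in> Q_B" "q * \<pi> = \<pi> * q'" using Q_B_pi[OF q] by blast
  have "q * x = sqrt2 *\<^sub>K ((q * \<pi>) * u)" by (simp add: u mult.assoc)
  also have "\<dots> = sqrt2 *\<^sub>K (\<pi> * (q' * u))" by (simp only: q' mult.assoc)
  finally have "q * x = sqrt2 *\<^sub>K (\<pi> * (q' * u))" .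
  then show "q * x \<in> prime_cubed" unfolding prime_cubed_def using Q_B_closed(2)[OF q'(1) u(1)] by blast
qed

section \<open>The quotient by the Bolza group\<close>

definition bolza_equiv :: "D_B \<Rightarrow> D_B \<Rightarrow> bool"  (infix "\<doteq>" 50)
  where "x \<doteq> y \<longleftrightarrow> x \<in> carrier Q_B1 \<and> y \<in> carrier Q_B1 \<and> qconj x * y \<in> Bolza_lift"

lemmas Bolza_liftD = signed_normalD[OF signed_normal_Bolza_lift]

lemma equiv_carrier: "x \<doteq> y \<Longrightarrow> x \<in> carrier Q_B1 \<and> y \<in> carrier Q_B1"
  by (simp add: bolza_equiv_def)

lemma equiv_refl: "x \<in> carrier Q_B1 \<Longrightarrow> x \<doteq> x"
  by (simp add: bolza_equiv_def Q_B1_inverse Bolza_liftD(2))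

lemma equiv_uminus: "x \<in> carrier Q_B1 \<Longrightarrow> x \<doteq> - x"
  by (simp add: bolza_equiv_def Q_B1_inverse Bolza_liftD(2,4))

lemma equiv_sym: "x \<doteq> y \<Longrightarrow> y \<doteq> x"
  using Bolza_liftD(5)[of "qconj x * y"] by (simp add: bolza_equiv_def qconj_mult)

lemma equiv_trans [trans]:
  assumes "x \<doteq> y" "y \<doteq> z"
  shows "x \<doteq> z"
proof -
  have "(qconj x * y) * (qconj y * z) \<in> Bolza_lift"
    using assms Bolza_liftD(3) by (simp add: bolza_equiv_def)
  then show ?thesis using assms by (simp add: bolza_equiv_def mult.assoc Q_B1_inverse)
qed

lemma equiv_mult:
  assumes "x \<doteq> x'" "y \<doteq> y'"
  shows "x * y \<doteq> x' * y'"
proof -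
  have y: "y \<in> carrier Q_B1" and x: "x \<in> carrier Q_B1" using assms by (simp_all add: bolza_equiv_def)
  have "qconj y * (qconj x * x') * qconj (qconj y) * (qconj y * y') \<in> Bolza_lift"
    using assms Bolza_liftD(6)[OF Q_B1_closed(7)[OF y]] Bolza_liftD(3) by (simp add: bolza_equiv_def)
  then have "qconj (x * y) * (x' * y') \<in> Bolza_lift"
    by (simp add: mult.assoc qconj_mult Q_B1_inverse[OF y])
  then show ?thesis using assms by (simp add: bolza_equiv_def)
qed

lemma equiv_mult_left: "g \<in> carrier Q_B1 \<Longrightarrow> x \<doteq> y \<Longrightarrow> g * x \<doteq> g * y"
  by (intro equiv_mult equiv_refl)

lemma equiv_mult_right: "g \<in> carrier Q_B1 \<Longrightarrow> x \<doteq> y \<Longrightarrow> x * g \<doteq> y * g"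
  by (intro equiv_mult equiv_refl)

lemma equiv_power: "x \<doteq> y \<Longrightarrow> x ^ n \<doteq> y ^ n"
  by (induction n) (auto intro: equiv_mult equiv_refl)

lemma equiv_power_mod:
  assumes "x \<in> carrier Q_B1" "x ^ m \<doteq> 1"
  shows "x ^ n \<doteq> x ^ (n mod m)"
proof -
  have "x ^ n = (x ^ m) ^ (n div m) * x ^ (n mod m)"
    by (simp flip: power_mult power_add)
  also have "\<dots> \<doteq> 1 ^ (n div m) * x ^ (n mod m)"
    using assms by (intro equiv_mult equiv_power equiv_refl) auto
  finally show ?thesis by simp
qed

lemma qconj_alpha: "qconj \<alpha> = - (\<alpha>\<^sup>2)" and qconj_beta: "qconj \<beta> = - (\<beta>\<^sup>2)"
  by (simp_all add: power2_eq_square alpha_coords beta_coords qconj_def times_D_B_def uminus_D_B_def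
      field_simps sqrt2_squared sqrt2_sqrt2)

lemma delta_conjugate: "\<delta> = qconj \<alpha> * \<gamma> * \<alpha>"
  by (simp add: \<delta>_def \<gamma>_def mult.assoc Q_B1_inverse[OF Q_B1_closed(2)])

lemma conjugate_power:
  assumes "g \<in> carrier Q_B1"
  shows "(qconj g * x * g) ^ n = qconj g * x ^ n * g"
proof (induction n)
  case 0
  show ?case by (simp add: Q_B1_inverse[OF assms])
next
  case (Suc n)
  then show ?case by (simp add: mult.assoc Q_B1_inverse[OF assms])
qed

lemma delta_fourth: "\<delta> ^ 4 = - 1"
  unfolding delta_conjugate conjugate_power[OF Q_B1_closed(2)] gamma_powers
  by (simp add: Q_B1_inverse)

text \<open>The third conjugate of \<open>\<gamma>\<close> under \<open>\<alpha>\<close>: conjugation by \<open>\<alpha>\<close> permutes \<open>\<gamma>, \<delta>, \<epsilon>\<close> cyclically, and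
\<open>\<gamma>\<delta>\<epsilon> = 1\<close> holds before any quotient is taken. In the quotient these become the quaternion units.\<close>

definition \<epsilon> :: D_B where "\<epsilon> = qconj \<delta> * qconj \<gamma>"

lemma epsilon_conjugate: "\<epsilon> = qconj \<alpha> * \<delta> * \<alpha>"
proof -
  have "\<gamma> * \<delta> = - (\<alpha> * qconj \<beta> * \<alpha>)"
    by (simp add: \<gamma>_def \<delta>_def qconj_beta power2_eq_square mult.assoc)
  then have "\<epsilon> = - (qconj \<alpha> * \<beta> * qconj \<alpha>)"
    by (simp add: \<epsilon>_def flip: qconj_mult) (simp add: qconj_mult mult.assoc)
  then show ?thesis
    by (simp add: \<delta>_def qconj_alpha power2_eq_square mult.assoc)
qed

lemma epsilon_Q_B1: "\<epsilon> \<in> carrier Q_B1"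
  by (simp add: \<epsilon>_def)

lemma qconj_gamma: "qconj \<gamma> = - (\<gamma> ^ 3)" and qconj_delta: "qconj \<delta> = - (\<delta> ^ 3)"
proof -
  have *: "qconj x = - (x ^ 3)" if "x \<in> carrier Q_B1" "x ^ 4 = - 1" for x
  proof -
    have "x ^ 4 = x * x ^ 3" by (simp add: eval_nat_numeral)
    then have "qconj x * x ^ 4 = x ^ 3" by (simp only: Q_B1_inverse(4)[OF that(1)])
    then have "- qconj x = x ^ 3" unfolding that(2) by simp
    from arg_cong[OF this, of uminus] show ?thesis by simp
  qed
  show "qconj \<gamma> = - (\<gamma> ^ 3)" by (rule *[OF _ gamma_powers(3)]) simp
  show "qconj \<delta> = - (\<delta> ^ 3)" by (rule *[OF _ delta_fourth]) simp
qed

lemma bolza_relator_gamma_delta: "bolza_relator = \<gamma>\<^sup>2 * (qconj \<delta>)\<^sup>2"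
proof -
  have "\<alpha>\<^sup>2 * \<beta>\<^sup>2 = qconj \<delta>" by (simp add: \<delta>_def qconj_mult qconj_alpha qconj_beta)
  then show ?thesis by (simp add: bolza_relator_def \<gamma>_def)
qed

text \<open>This is all that the relator says: it equals \<open>\<gamma>\<^sup>2 \<delta>\<^sup>-\<^sup>2\<close>.\<close>

lemma gamma2_equiv_delta2: "\<gamma>\<^sup>2 \<doteq> \<delta>\<^sup>2"
proof -
  have c: "\<gamma>\<^sup>2 \<in> carrier Q_B1" "\<delta>\<^sup>2 \<in> carrier Q_B1" by simp_all
  have q: "(qconj \<delta>)\<^sup>2 = qconj (\<delta>\<^sup>2)" by (simp add: power2_eq_square qconj_mult)
  have "qconj (qconj (\<gamma>\<^sup>2)) * (qconj (\<delta>\<^sup>2)) \<in> Bolza_lift"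
    using bolza_relator_lift by (simp add: bolza_relator_gamma_delta q)
  then have "qconj (\<gamma>\<^sup>2) \<doteq> qconj (\<delta>\<^sup>2)" using c by (simp add: bolza_equiv_def)
  moreover have "qconj (x\<^sup>2) = - (x\<^sup>2)" if "x \<in> carrier Q_B1" "x ^ 4 = - 1" for x
  proof -
    have "qconj (x\<^sup>2) * x ^ 4 = qconj (x\<^sup>2) * (x\<^sup>2 * x\<^sup>2)" by (simp flip: power_add)
    also have "\<dots> = x\<^sup>2" by (rule Q_B1_inverse(4)) (simp add: that(1))
    finally have "- qconj (x\<^sup>2) = x\<^sup>2" unfolding that(2) by simp
    from arg_cong[OF this, of uminus] show ?thesis by simp
  qed
  then have "qconj (\<gamma>\<^sup>2) = - (\<gamma>\<^sup>2)" "qconj (\<delta>\<^sup>2) = - (\<delta>\<^sup>2)"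
    using gamma_powers(3) delta_fourth by blast+
  ultimately have "- (\<gamma>\<^sup>2) \<doteq> - (\<delta>\<^sup>2)" by (simp only:)
  from equiv_mult_left[OF Q_B1_closed(6)[OF Q_B1_closed(1)] this] show ?thesis by simp
qed

text \<open>The commutation rule of the quaternion group. Conjugating \<open>\<gamma>\<^sup>2 \<doteq> \<delta>\<^sup>2\<close> by \<open>\<alpha>\<close> gives \<open>\<delta>\<^sup>2 \<doteq> \<epsilon>\<^sup>2\<close>, and
\<open>\<epsilon>\<close> is the inverse of \<open>\<gamma>\<delta>\<close>; so \<open>(\<gamma>\<delta>)\<^sup>2 \<doteq> \<delta>\<^sup>2\<close> up to sign, which is \<open>\<gamma>\<delta>\<gamma> \<doteq> \<delta>\<close>.\<close>

lemma delta_gamma: "\<delta> * \<gamma> \<doteq> \<gamma> ^ 3 * \<delta>"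
proof -
  have c [simp]: "\<gamma> \<in> carrier Q_B1" "\<delta> \<in> carrier Q_B1" "\<epsilon> \<in> carrier Q_B1" "\<alpha> \<in> carrier Q_B1"
    using epsilon_Q_B1 by simp_all
  have "\<epsilon>\<^sup>2 = qconj \<alpha> * \<delta>\<^sup>2 * \<alpha>"
    unfolding epsilon_conjugate by (rule conjugate_power) simp
  also have "\<dots> \<doteq> qconj \<alpha> * \<gamma>\<^sup>2 * \<alpha>"
    by (intro equiv_mult equiv_refl equiv_sym[OF gamma2_equiv_delta2]) simp_all
  also have "\<dots> = \<delta>\<^sup>2"
    unfolding delta_conjugate by (rule conjugate_power[symmetric]) simp
  finally have e: "\<epsilon>\<^sup>2 \<doteq> \<delta>\<^sup>2" .
  have d4: "\<delta>\<^sup>2 * \<delta>\<^sup>2 = - 1" using delta_fourth by (simp flip: power_add)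
  have ge: "(\<gamma> * \<delta>) * \<epsilon> = 1"
    using Q_B1_inverse(1)[of "\<gamma> * \<delta>"] by (simp add: \<epsilon>_def flip: qconj_mult)
  have "(\<gamma> * \<delta>)\<^sup>2 * \<epsilon>\<^sup>2 = (\<gamma> * \<delta>) * ((\<gamma> * \<delta>) * \<epsilon>) * \<epsilon>" by (simp add: power2_eq_square mult.assoc)
  then have "(\<gamma> * \<delta>)\<^sup>2 * \<epsilon>\<^sup>2 = 1" by (simp add: ge)
  then have "1 \<doteq> (\<gamma> * \<delta>)\<^sup>2 * \<delta>\<^sup>2"
    using equiv_mult_left[OF _ e, of "(\<gamma> * \<delta>)\<^sup>2"] by simp
  then have "1 * \<delta>\<^sup>2 \<doteq> (\<gamma> * \<delta>)\<^sup>2 * \<delta>\<^sup>2 * \<delta>\<^sup>2" by (intro equiv_mult_right) simp_all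
  then have "\<delta>\<^sup>2 \<doteq> - ((\<gamma> * \<delta>)\<^sup>2)" unfolding mult.assoc d4 by simp
  moreover have "(\<gamma> * \<delta>)\<^sup>2 \<doteq> - ((\<gamma> * \<delta>)\<^sup>2)" by (rule equiv_uminus) simp
  ultimately have "(\<gamma> * \<delta>)\<^sup>2 \<doteq> \<delta>\<^sup>2" using equiv_sym equiv_trans by blast
  then have "(\<gamma> * \<delta> * \<gamma>) * \<delta> \<doteq> \<delta> * \<delta>" unfolding power2_eq_square mult.assoc .
  then have "(\<gamma> * \<delta> * \<gamma>) * \<delta> * qconj \<delta> \<doteq> \<delta> * \<delta> * qconj \<delta>"
    by (rule equiv_mult_right[rotated]) simp
  then have "\<gamma> * \<delta> * \<gamma> \<doteq> \<delta>" unfolding mult.assoc Q_B1_inverse(1)[OF c(2)] by simp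
  then have "\<gamma> ^ 3 * (\<gamma> * \<delta> * \<gamma>) \<doteq> \<gamma> ^ 3 * \<delta>" by (intro equiv_mult_left) simp_all
  moreover have "\<gamma> ^ 3 * (\<gamma> * \<delta> * \<gamma>) = - (\<delta> * \<gamma>)"
    using gamma_powers(3) by (simp add: eval_nat_numeral mult.assoc[symmetric]) 
  moreover have "\<delta> * \<gamma> \<doteq> - (\<delta> * \<gamma>)" by (intro equiv_uminus) simp
  ultimately show ?thesis using equiv_trans by simp
qed

definition quaternion_cosets :: "D_B set"
  where "quaternion_cosets = {x. \<exists>k l. x \<doteq> \<gamma> ^ k * \<delta> ^ l}"

lemma quaternion_cosets_gamma: "x \<in> quaternion_cosets \<Longrightarrow> \<gamma> * x \<in> quaternion_cosets"
proof -
  assume "x \<in> quaternion_cosets"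
  then obtain k l where "x \<doteq> \<gamma> ^ k * \<delta> ^ l" by (auto simp: quaternion_cosets_def)
  then have "\<gamma> * x \<doteq> \<gamma> * (\<gamma> ^ k * \<delta> ^ l)" by (intro equiv_mult_left) simp_all
  then have "\<gamma> * x \<doteq> \<gamma> ^ Suc k * \<delta> ^ l" by (simp add: mult.assoc)
  then show ?thesis unfolding quaternion_cosets_def by blast
qed

text \<open>The exponent \<open>3 k\<close> stands for \<open>- k\<close>, as \<open>\<gamma>\<^sup>4 = -1\<close> is trivial in the quotient.\<close>

lemma delta_gamma_power: "\<delta> * \<gamma> ^ k \<doteq> \<gamma> ^ (3 * k) * \<delta>"
proof (induction k)
  case 0
  show ?case by (simp add: equiv_refl)
next
  case (Suc k)
  have "\<delta> * \<gamma> ^ Suc k = (\<delta> * \<gamma> ^ k) * \<gamma>" by (simp add: mult.assoc power_commutes)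
  also have "\<dots> \<doteq> (\<gamma> ^ (3 * k) * \<delta>) * \<gamma>" using Suc by (intro equiv_mult_right) simp_all
  also have "\<dots> = \<gamma> ^ (3 * k) * (\<delta> * \<gamma>)" by (rule mult.assoc)
  also have "\<dots> \<doteq> \<gamma> ^ (3 * k) * (\<gamma> ^ 3 * \<delta>)" by (intro equiv_mult_left delta_gamma) simp
  also have "\<dots> = \<gamma> ^ (3 * Suc k) * \<delta>" by (simp add: mult.assoc[symmetric] flip: power_add) (simp add: add.commute)
  finally show ?case .
qed

lemma quaternion_cosets_delta:
  assumes "x \<in> quaternion_cosets"
  shows "\<delta> * x \<in> quaternion_cosets"
proof -
  obtain k l where x: "x \<doteq> \<gamma> ^ k * \<delta> ^ l" using assms by (auto simp: quaternion_cosets_def)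
  have "\<delta> * x \<doteq> \<delta> * (\<gamma> ^ k * \<delta> ^ l)" using x by (intro equiv_mult_left) simp_all
  also have "\<dots> = (\<delta> * \<gamma> ^ k) * \<delta> ^ l" by (simp add: mult.assoc)
  also have "\<dots> \<doteq> (\<gamma> ^ (3 * k) * \<delta>) * \<delta> ^ l" by (intro equiv_mult_right delta_gamma_power) simp
  also have "\<dots> = \<gamma> ^ (3 * k) * \<delta> ^ Suc l" by (simp add: mult.assoc)
  finally show ?thesis unfolding quaternion_cosets_def by blast
qed

text \<open>Moving \<open>\<gamma>\<close> or \<open>\<delta>\<close> past a power of \<open>\<alpha>\<close> permutes \<open>\<gamma>, \<delta>, \<epsilon>\<close>, and all three preserve the cosets
\<open>\<gamma>\<^sup>k \<delta>\<^sup>l\<close>; \<open>\<epsilon>\<close> does so because it is a product of powers of the other two.\<close>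

lemma pass_alpha_power:
  "\<forall>t\<in>quaternion_cosets. (\<exists>t'\<in>quaternion_cosets. \<gamma> * (\<alpha> ^ i * t) \<doteq> \<alpha> ^ i * t')
    \<and> (\<exists>t'\<in>quaternion_cosets. \<delta> * (\<alpha> ^ i * t) \<doteq> \<alpha> ^ i * t')"
proof (induction i)
  case 0
  have "\<gamma> * t \<doteq> \<gamma> * t" "\<delta> * t \<doteq> \<delta> * t" if "t \<in> quaternion_cosets" for t
    using that by (auto simp: quaternion_cosets_def dest!: equiv_carrier intro!: equiv_refl)
  then show ?case using quaternion_cosets_gamma quaternion_cosets_delta by (simp, blast)
next
  case (Suc i)
  define passes where "passes x \<longleftrightarrow> x \<in> carrier Q_B1 \<and>
    (\<forall>t\<in>quaternion_cosets. \<exists>t'\<in>quaternion_cosets. x * (\<alpha> ^ i * t) \<doteq> \<alpha> ^ i * t')" for x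
  have g: "passes \<gamma>" and d: "passes \<delta>" using Suc by (simp_all add: passes_def)
  have m: "passes (x * y)" if x: "passes x" and y: "passes y" for x y
    unfolding passes_def
  proof (intro conjI ballI)
    show "x * y \<in> carrier Q_B1" using x y by (simp add: passes_def)
    fix t assume "t \<in> quaternion_cosets"
    then obtain s where s: "s \<in> quaternion_cosets" "y * (\<alpha> ^ i * t) \<doteq> \<alpha> ^ i * s"
      using y unfolding passes_def by blast
    obtain r where r: "r \<in> quaternion_cosets" "x * (\<alpha> ^ i * s) \<doteq> \<alpha> ^ i * r"
      using s x unfolding passes_def by blast
    have "x * (y * (\<alpha> ^ i * t)) \<doteq> x * (\<alpha> ^ i * s)"
      using s x by (intro equiv_mult_left) (simp_all add: passes_def)
    from equiv_trans[OF this r(2)] r(1)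
    show "\<exists>t'\<in>quaternion_cosets. x * y * (\<alpha> ^ i * t) \<doteq> \<alpha> ^ i * t'" by (auto simp: mult.assoc)
  qed
  have e: "passes \<epsilon>"
  proof -
    have "\<epsilon> = (\<delta> * (\<delta> * \<delta>)) * (\<gamma> * (\<gamma> * \<gamma>))"
      by (simp add: \<epsilon>_def qconj_gamma qconj_delta eval_nat_numeral)
    moreover have "passes ((\<delta> * (\<delta> * \<delta>)) * (\<gamma> * (\<gamma> * \<gamma>)))" by (intro m g d)
    ultimately show ?thesis by (simp only:)
  qed
  have step: "\<exists>t'\<in>quaternion_cosets. x * (\<alpha> ^ Suc i * t) \<doteq> \<alpha> ^ Suc i * t'"
    if y: "passes y" and xy: "x * \<alpha> = \<alpha> * y" and t: "t \<in> quaternion_cosets" for x y t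
  proof -
    obtain s where s: "s \<in> quaternion_cosets" "y * (\<alpha> ^ i * t) \<doteq> \<alpha> ^ i * s"
      using y t unfolding passes_def by blast
    have "x * (\<alpha> ^ Suc i * t) = (x * \<alpha>) * (\<alpha> ^ i * t)" by (simp add: mult.assoc)
    also have "\<dots> = \<alpha> * (y * (\<alpha> ^ i * t))" by (simp only: xy mult.assoc)
    also have "\<dots> \<doteq> \<alpha> * (\<alpha> ^ i * s)" using s by (intro equiv_mult_left) simp_all
    also have "\<dots> = \<alpha> ^ Suc i * s" by (simp add: mult.assoc)
    finally show ?thesis using s(1) by blast
  qed
  have "\<gamma> * \<alpha> = \<alpha> * \<delta>" by (simp add: \<gamma>_def \<delta>_def mult.assoc)
  moreover have "\<delta> * \<alpha> = \<alpha> * \<epsilon>"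
    by (simp add: epsilon_conjugate mult.assoc Q_B1_inverse[OF Q_B1_closed(2)])
  ultimately show ?case using step d e by blast
qed

text \<open>The union of the cosets \<open>\<alpha>\<^sup>i \<gamma>\<^sup>k \<delta>\<^sup>l\<close> is closed under the generators, so it is everything. The exponents
reduce by \<open>\<alpha>\<^sup>3 = -1\<close>, \<open>\<delta>\<^sup>2 \<doteq> \<gamma>\<^sup>2\<close> and \<open>\<gamma>\<^sup>4 = -1\<close>.\<close>

lemma coset_representatives:
  assumes "x \<in> carrier Q_B1"
  shows "\<exists>i<3. \<exists>k<4. \<exists>l<2. x \<doteq> \<alpha> ^ i * (\<gamma> ^ k * \<delta> ^ l)"
proof -
  define S where "S = {x. \<exists>i. \<exists>t\<in>quaternion_cosets. x \<doteq> \<alpha> ^ i * t}"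
  have al: "\<alpha> * x \<in> S" if "x \<in> S" for x
  proof -
    obtain i t where t: "t \<in> quaternion_cosets" "x \<doteq> \<alpha> ^ i * t" using \<open>x \<in> S\<close> by (auto simp: S_def)
    have "\<alpha> * x \<doteq> \<alpha> * (\<alpha> ^ i * t)" using t by (intro equiv_mult_left) simp_all
    then have "\<alpha> * x \<doteq> \<alpha> ^ Suc i * t" by (simp add: mult.assoc)
    then show ?thesis using t(1) unfolding S_def by blast
  qed
  have ga: "\<gamma> * x \<in> S" if "x \<in> S" for x
  proof -
    obtain i t where t: "t \<in> quaternion_cosets" "x \<doteq> \<alpha> ^ i * t" using \<open>x \<in> S\<close> by (auto simp: S_def)
    obtain t' where t': "t' \<in> quaternion_cosets" "\<gamma> * (\<alpha> ^ i * t) \<doteq> \<alpha> ^ i * t'"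
      using pass_alpha_power t(1) by blast
    have "\<gamma> * x \<doteq> \<gamma> * (\<alpha> ^ i * t)" using t by (intro equiv_mult_left) simp_all
    from equiv_trans[OF this t'(2)] t'(1) show ?thesis unfolding S_def by blast
  qed
  have neg: "- x \<in> S" if "x \<in> S" for x
  proof -
    obtain i t where t: "t \<in> quaternion_cosets" "x \<doteq> \<alpha> ^ i * t" using \<open>x \<in> S\<close> by (auto simp: S_def)
    have "- x \<doteq> x" using t equiv_carrier by (blast intro: equiv_sym equiv_uminus)
    from equiv_trans[OF this t(2)] t(1) show ?thesis unfolding S_def by blast
  qed
  have be: "\<beta> * x \<in> S" if "x \<in> S" for x
  proof -
    have "- (\<alpha> * (\<alpha> * (\<gamma> * x))) = qconj \<alpha> * (\<alpha> * (\<beta> * x))"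
      by (simp add: qconj_alpha power2_eq_square \<gamma>_def mult.assoc)
    then have "\<beta> * x = - (\<alpha> * (\<alpha> * (\<gamma> * x)))" by (simp add: Q_B1_inverse)
    then show ?thesis using that al ga neg by simp
  qed
  have "1 \<doteq> \<gamma> ^ 0 * \<delta> ^ 0" by (simp add: equiv_refl)
  then have "1 \<in> quaternion_cosets" unfolding quaternion_cosets_def by blast
  moreover have "1 \<doteq> \<alpha> ^ 0 * 1" by (simp add: equiv_refl)
  ultimately have one: "1 \<in> S" unfolding S_def by blast
  have "x \<in> Q_B" "nrd x = 1" using assms by (simp_all add: carrier_Q_B1)
  from Q_B1_generated[OF this one al be neg] have "x \<in> S" .
  then obtain i t where t: "t \<in> quaternion_cosets" "x \<doteq> \<alpha> ^ i * t" by (auto simp: S_def)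
  then obtain k l where kl: "t \<doteq> \<gamma> ^ k * \<delta> ^ l" by (auto simp: quaternion_cosets_def)
  have minus: "- 1 \<doteq> 1" using equiv_sym[OF equiv_uminus[of 1]] by simp
  have i: "\<alpha> ^ i \<doteq> \<alpha> ^ (i mod 3)"
    using minus by (intro equiv_power_mod) (simp_all add: alpha_cubed)
  have "\<delta> ^ l = (\<delta>\<^sup>2) ^ (l div 2) * \<delta> ^ (l mod 2)" by (simp flip: power_mult power_add)
  also have "\<dots> \<doteq> (\<gamma>\<^sup>2) ^ (l div 2) * \<delta> ^ (l mod 2)"
    by (intro equiv_mult equiv_power equiv_sym[OF gamma2_equiv_delta2] equiv_refl) simp
  finally have "\<gamma> ^ k * \<delta> ^ l \<doteq> \<gamma> ^ k * ((\<gamma>\<^sup>2) ^ (l div 2) * \<delta> ^ (l mod 2))"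
    by (intro equiv_mult_left) simp_all
  also have "\<dots> = \<gamma> ^ (k + 2 * (l div 2)) * \<delta> ^ (l mod 2)"
    by (simp add: power_add power_mult mult.assoc)
  also have "\<dots> \<doteq> \<gamma> ^ ((k + 2 * (l div 2)) mod 4) * \<delta> ^ (l mod 2)"
    using minus by (intro equiv_mult_right equiv_power_mod) (simp_all add: gamma_powers)
  finally have "\<alpha> ^ i * t \<doteq> \<alpha> ^ (i mod 3) * (\<gamma> ^ ((k + 2 * (l div 2)) mod 4) * \<delta> ^ (l mod 2))"
    using i kl equiv_trans by (blast intro: equiv_mult)
  then have "x \<doteq> \<alpha> ^ (i mod 3) * (\<gamma> ^ ((k + 2 * (l div 2)) mod 4) * \<delta> ^ (l mod 2))"
    using t equiv_trans by blast
  moreover have "i mod 3 < 3" "(k + 2 * (l div 2)) mod 4 < 4" "l mod 2 < 2" by simp_all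
  ultimately show ?thesis by blast
qed

section \<open>The Bolza group is a congruence subgroup\<close>

lemma trace_lin: "2 * co1 (lin a b c d) = 2 * a + b + c - d * sqrt2"
  by (simp add: lin_coords field_simps)

lemma nrd_one_plus: "nrd (1 + x) = 1 + 2 * co1 x + nrd x"
  by (simp add: nrd_def one_D_B_def plus_D_B_def power2_eq_square algebra_simps)

text \<open>For \<open>x = 1 + z\<close> of norm \<open>1\<close> the trace of \<open>z\<close> is minus its norm, and the norm of an element of \<open>P\<^sup>3\<close> is divisible
by \<open>2 sqrt 2\<close>. This is sharper by a factor \<open>sqrt 2\<close> than what linearity of the trace would give, and
the sharper form is needed to exclude \<open>\<gamma>\<^sup>2\<close>, whose trace is \<open>0\<close>.\<close>

lemma trace_prime_cubed:
  assumes "x \<in> congruence_subgroup prime_cubed"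
  shows "\<exists>k\<in>O_K. 2 * co1 x = 2 + 2 * sqrt2 * k"
proof -
  obtain y where y: "y \<in> Q_B" "x - 1 = sqrt2 *\<^sub>K (\<pi> * y)" and n: "nrd x = 1"
    using assms by (auto simp: congruence_subgroup_def prime_cubed_def carrier_Q_B1)
  define z where "z = sqrt2 *\<^sub>K (\<pi> * y)"
  have x: "x = 1 + z" using y(2) by (simp add: z_def algebra_simps)
  have "nrd (sqrt2 *\<^sub>K u) = 2 * nrd u" for u
    by (simp add: nrd_def scale_def power2_eq_square algebra_simps sqrt2_squared sqrt2_sqrt2)
  then have "nrd z = 2 * sqrt2 * ((1 + sqrt2) * nrd y)"
    by (simp add: z_def nrd_mult nrd_pi algebra_simps sqrt2_squared sqrt2_sqrt2)
  moreover have "2 * co1 z = - nrd z"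
    using n nrd_one_plus[of z] unfolding x by (simp add: add_eq_0_iff)
  ultimately have "2 * co1 x = 2 + 2 * sqrt2 * (- ((1 + sqrt2) * nrd y))"
    unfolding x by simp
  moreover have "- ((1 + sqrt2) * nrd y) \<in> O_K"
    by (intro uminus_O_K O_K_closed one_O_K sqrt2_O_K nrd_O_K y(1))
  ultimately show ?thesis by blast
qed

lemma alpha_squared: "\<alpha>\<^sup>2 = lin (- 1) 1 0 0"
  by (simp add: power2_eq_square alpha_lin lin_mult)

lemma representative_traces:
  shows "2 * co1 (\<alpha> ^ 0 * (\<gamma> ^ 0 * \<delta> ^ 1)) = - sqrt2"
    "2 * co1 (\<alpha> ^ 0 * (\<gamma> ^ 1 * \<delta> ^ 0)) = - sqrt2" "2 * co1 (\<alpha> ^ 0 * (\<gamma> ^ 1 * \<delta> ^ 1)) = - sqrt2"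
    "2 * co1 (\<alpha> ^ 0 * (\<gamma> ^ 2 * \<delta> ^ 0)) = 0" "2 * co1 (\<alpha> ^ 0 * (\<gamma> ^ 2 * \<delta> ^ 1)) = 2 + sqrt2"
    "2 * co1 (\<alpha> ^ 0 * (\<gamma> ^ 3 * \<delta> ^ 0)) = sqrt2" "2 * co1 (\<alpha> ^ 0 * (\<gamma> ^ 3 * \<delta> ^ 1)) = - 2 - sqrt2"
    "2 * co1 (\<alpha> ^ 1 * (\<gamma> ^ 0 * \<delta> ^ 0)) = 1" "2 * co1 (\<alpha> ^ 1 * (\<gamma> ^ 0 * \<delta> ^ 1)) = - 1 - sqrt2"
    "2 * co1 (\<alpha> ^ 1 * (\<gamma> ^ 1 * \<delta> ^ 0)) = - 1 - sqrt2" "2 * co1 (\<alpha> ^ 1 * (\<gamma> ^ 1 * \<delta> ^ 1)) = 1"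
    "2 * co1 (\<alpha> ^ 1 * (\<gamma> ^ 2 * \<delta> ^ 0)) = 1 + sqrt2" "2 * co1 (\<alpha> ^ 1 * (\<gamma> ^ 2 * \<delta> ^ 1)) = 1"
    "2 * co1 (\<alpha> ^ 1 * (\<gamma> ^ 3 * \<delta> ^ 0)) = - 1" "2 * co1 (\<alpha> ^ 1 * (\<gamma> ^ 3 * \<delta> ^ 1)) = - 1 - sqrt2"
    "2 * co1 (\<alpha> ^ 2 * (\<gamma> ^ 0 * \<delta> ^ 0)) = - 1" "2 * co1 (\<alpha> ^ 2 * (\<gamma> ^ 0 * \<delta> ^ 1)) = - 1"
    "2 * co1 (\<alpha> ^ 2 * (\<gamma> ^ 1 * \<delta> ^ 0)) = - 1" "2 * co1 (\<alpha> ^ 2 * (\<gamma> ^ 1 * \<delta> ^ 1)) = 1 + sqrt2"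
    "2 * co1 (\<alpha> ^ 2 * (\<gamma> ^ 2 * \<delta> ^ 0)) = 1 + sqrt2" "2 * co1 (\<alpha> ^ 2 * (\<gamma> ^ 2 * \<delta> ^ 1)) = - 1 - sqrt2"
    "2 * co1 (\<alpha> ^ 2 * (\<gamma> ^ 3 * \<delta> ^ 0)) = - 1 - sqrt2" "2 * co1 (\<alpha> ^ 2 * (\<gamma> ^ 3 * \<delta> ^ 1)) = 1"
  unfolding power_0 power_one_right mult_1 mult_1_right alpha_squared gamma_powers
  unfolding alpha_lin gamma_lin delta_lin lin_mult trace_lin
  by (simp_all add: algebra_simps sqrt2_squared sqrt2_sqrt2)

text \<open>None of the \<open>23\<close> traces is \<open>2\<close> modulo \<open>2 sqrt 2\<close>: a number \<open>m + n sqrt 2\<close> is so exactly when \<open>m\<close> is \<open>2\<close>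
modulo \<open>4\<close> and \<open>n\<close> is even.\<close>

lemma representative_trivial:
  assumes "i < 3" "k < 4" "l < 2"
    and "\<alpha> ^ i * (\<gamma> ^ k * \<delta> ^ l) \<in> congruence_subgroup prime_cubed"
  shows "\<alpha> ^ i * (\<gamma> ^ k * \<delta> ^ l) = 1"
proof (rule ccontr)
  assume "\<not> ?thesis"
  then have "(i, k, l) \<noteq> (0, 0, 0)" by (metis mult_1 power_0 prod.inject)
  moreover have "i \<in> {0, 1, 2}" "k \<in> {0, 1, 2, 3}" "l \<in> {0, 1}" using assms by auto
  ultimately have trace: "2 * co1 (\<alpha> ^ i * (\<gamma> ^ k * \<delta> ^ l)) \<in>
    {0, sqrt2, - sqrt2, 2 + sqrt2, - 2 - sqrt2, 1, - 1, 1 + sqrt2, - 1 - sqrt2}"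
    by (elim insertE emptyE; hypsubst) (simp_all only: representative_traces insert_iff simp_thms)
  define t where "t = 2 * co1 (\<alpha> ^ i * (\<gamma> ^ k * \<delta> ^ l))"
  obtain c where c: "c \<in> O_K" "t = 2 + 2 * sqrt2 * c"
    using trace_prime_cubed[OF assms(4)] unfolding t_def by blast
  then obtain a b where "c = of_int a + of_int b * sqrt2" by (auto simp: O_K_def)
  then have tab: "t = of_int (2 + 4 * b) + of_int (2 * a) * sqrt2"
    using c by (simp add: algebra_simps sqrt2_squared sqrt2_sqrt2)
  have ne: "t \<noteq> of_int m + of_int n * sqrt2" if "m mod 4 \<noteq> 2 \<or> odd n" for m n
  proof
    assume "t = of_int m + of_int n * sqrt2"
    then have "m = 2 + 4 * b \<and> n = 2 * a" unfolding tab by (metis of_int_sqrt2_unique)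
    with that show False by presburger
  qed
  have "t \<notin> {0, sqrt2, - sqrt2, 2 + sqrt2, - 2 - sqrt2, 1, - 1, 1 + sqrt2, - 1 - sqrt2}"
    using ne[of 0 0] ne[of 0 1] ne[of 0 "-1"] ne[of 2 1] ne[of "-2" "-1"] ne[of 1 0] ne[of "-1" 0]
      ne[of 1 1] ne[of "-1" "-1"] by simp
  with trace show False unfolding t_def by blast
qed

text \<open>The cofactor is \<open>sqrt 2\<close> times the conjugate of \<open>\<pi>\<close> divided by its norm; it is integral because
\<open>sqrt 2\<close> and the norm of \<open>\<pi>\<close> differ by the unit \<open>1 + sqrt 2\<close>.\<close>

lemma sqrt2_pi: "\<pi> * lin 1 0 0 (sqrt2 - 1) = sqrt2 *\<^sub>K 1"
  unfolding pi_lin lin_mult one_lin lin_scale by (simp add: algebra_simps sqrt2_squared)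

lemma twice_in_prime_cubed:
  assumes "y \<in> Q_B"
  shows "2 *\<^sub>K y \<in> prime_cubed"
proof -
  let ?t = "lin 1 0 0 (sqrt2 - 1)"
  have "?t \<in> Q_B"
    unfolding Q_B_lin using one_O_K zero_O_K O_K_closed(2)[OF sqrt2_O_K one_O_K] by blast
  then have "?t * y \<in> Q_B" using assms by (rule Q_B_closed(2))
  moreover have "2 *\<^sub>K y = sqrt2 *\<^sub>K (\<pi> * (?t * y))"
    unfolding mult.assoc[symmetric] sqrt2_pi by (simp add: sqrt2_squared)
  ultimately show ?thesis unfolding prime_cubed_def by blast
qed

lemma two_D_B: "(2 :: D_B) = 2 *\<^sub>K 1"
proof -
  have "(1 + 1) *\<^sub>K 1 = (1 + 1 :: D_B)" unfolding D_B.scale_left_distrib D_B.scale_one ..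
  then show ?thesis by (simp only: one_add_one)
qed

lemma signed_normal_prime_cubed: "signed_normal (congruence_subgroup prime_cubed)"
  using signed_normal_congruence_subgroup[OF ideal_prime_cubed] twice_in_prime_cubed[OF one_Q_B]
  by (simp only: two_D_B)

lemma bolza_relator_lin: "bolza_relator = lin (1 + sqrt2) (2 + sqrt2) (- 2 - sqrt2) 0"
proof -
  have e: "\<alpha>\<^sup>2 * \<beta>\<^sup>2 = lin 1 (- 1) (- 1) 1"
    by (simp add: power2_eq_square alpha_lin beta_lin lin_mult)
  show ?thesis
    unfolding bolza_relator_def \<gamma>_def[symmetric] gamma_powers e
    unfolding power2_eq_square lin_mult
    by (simp add: lin_inject algebra_simps sqrt2_squared sqrt2_sqrt2)
qed

lemma bolza_relator_prime_cubed: "bolza_relator \<in> congruence_subgroup prime_cubed"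
proof -
  \<comment> \<open>The quotient of the relator minus \<open>1\<close> by \<open>sqrt 2 \<pi>\<close>.\<close>
  let ?y = "lin 0 sqrt2 (- 1) (1 - sqrt2)"
  have "bolza_relator - 1 = lin sqrt2 (2 + sqrt2) (- 2 - sqrt2) 0"
    unfolding bolza_relator_lin one_lin by (simp add: lin_def algebra_simps D_B.scale_left_distrib)
  also have "\<dots> = sqrt2 *\<^sub>K (\<pi> * ?y)"
    unfolding pi_lin lin_mult lin_scale by (simp add: algebra_simps sqrt2_squared sqrt2_sqrt2)
  finally have "bolza_relator - 1 = sqrt2 *\<^sub>K (\<pi> * ?y)" .
  moreover have "?y \<in> Q_B"
    unfolding Q_B_lin
    by (intro CollectI exI conjI, rule refl) (intro zero_O_K one_O_K sqrt2_O_K uminus_O_K O_K_closed)+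
  ultimately have "bolza_relator - 1 \<in> prime_cubed" unfolding prime_cubed_def by blast
  then show ?thesis by (simp add: congruence_subgroup_def bolza_relator_Q_B1)
qed

text \<open>An element \<open>x\<close> that is \<open>1\<close> modulo \<open>P\<^sup>3\<close> agrees modulo the Bolza group with a representative. The Bolza group
consists of elements that are \<open>1\<close> modulo \<open>P\<^sup>3\<close>, so the representative is one too and must be the identity.\<close>

theorem Bolza_lift_congruence: "Bolza_lift = congruence_subgroup prime_cubed"
proof
  note I = signed_normalD[OF signed_normal_prime_cubed]
  show sub: "Bolza_lift \<subseteq> congruence_subgroup prime_cubed"
    by (rule Bolza_lift_least[OF signed_normal_prime_cubed bolza_relator_prime_cubed])
  show "congruence_subgroup prime_cubed \<subseteq> Bolza_lift"
  proof
    fix x assume x: "x \<in> congruence_subgroup prime_cubed"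
    obtain i k l where b: "i < 3" "k < 4" "l < 2" and e: "x \<doteq> \<alpha> ^ i * (\<gamma> ^ k * \<delta> ^ l)"
      using coset_representatives[OF I(1)[OF x]] by blast
    define r where "r = \<alpha> ^ i * (\<gamma> ^ k * \<delta> ^ l)"
    have "qconj x * r \<in> congruence_subgroup prime_cubed"
      using e sub by (auto simp: bolza_equiv_def r_def)
    from I(3)[OF x this] have "r \<in> congruence_subgroup prime_cubed"
      by (simp add: Q_B1_inverse[OF I(1)[OF x]])
    then have "r = 1" unfolding r_def by (rule representative_trivial[OF b])
    then have "qconj x \<in> Bolza_lift" using e by (simp add: bolza_equiv_def r_def)
    from Bolza_liftD(5)[OF this] show "x \<in> Bolza_lift" by simp
  qed
qed

section \<open>The two strict inclusions\<close>

lemma signed_normal_principal: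
  assumes "c \<in> O_K" "2 = c * c'" "c' \<in> O_K"
  shows "signed_normal (Q_B1_cong (principal_OK c))"
proof -
  have "(2 :: D_B) = c *\<^sub>K (c' *\<^sub>K 1)" by (simp add: two_D_B assms(2))
  then have "2 \<in> ideal_times_Q_B (principal_OK c)"
    unfolding mem_principal using scale_Q_B[OF assms(3) one_Q_B] by blast
  then show ?thesis
    unfolding Q_B1_cong_principal
    by (rule signed_normal_congruence_subgroup[OF ideal_principal[OF assms(1)]])
qed

text \<open>The inclusion is \<open>P\<^sup>4 \<subseteq> P\<^sup>3\<close>. The first basis coordinate of the relator minus \<open>1\<close> is \<open>sqrt 2\<close>, which is not divisible
by \<open>2\<close>.\<close>

lemma congruence_two_psubset: "Q_B1_cong (principal_OK 2) \<subset> Bolza_lift"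
proof
  show "Q_B1_cong (principal_OK 2) \<subseteq> Bolza_lift"
    unfolding Bolza_lift_congruence
    using twice_in_prime_cubed by (auto simp: mem_Q_B1_cong congruence_subgroup_def carrier_Q_B1)
  have "bolza_relator \<notin> Q_B1_cong (principal_OK 2)"
  proof
    assume "bolza_relator \<in> Q_B1_cong (principal_OK 2)"
    then obtain y where "y \<in> Q_B" "bolza_relator - 1 = 2 *\<^sub>K y" by (auto simp: mem_Q_B1_cong)
    then obtain a b c d where a: "a \<in> O_K" and "bolza_relator = 1 + 2 *\<^sub>K lin a b c d"
      unfolding Q_B_lin by (auto simp: algebra_simps)
    then have "lin (1 + sqrt2) (2 + sqrt2) (- 2 - sqrt2) 0 = lin (1 + 2 * a) (2 * b) (2 * c) (2 * d)"
      unfolding bolza_relator_lin by (simp add: one_lin lin_scale lin_add)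
    then have "sqrt2 = 2 * a" by (simp add: lin_inject)
    moreover obtain m n where "a = of_int m + of_int n * sqrt2" using a by (auto simp: O_K_def)
    ultimately have "of_int 0 + of_int 1 * sqrt2 = of_int (2 * m) + of_int (2 * n) * sqrt2"
      by (simp add: algebra_simps)
    then have "1 = 2 * n" using of_int_sqrt2_unique by blast
    then show False by presburger
  qed
  then show "Q_B1_cong (principal_OK 2) \<noteq> Bolza_lift" using bolza_relator_lift by blast
qed

text \<open>The witness for strictness is \<open>\<gamma>\<^sup>2\<close>, the central involution of the quotient.\<close>

lemma Bolza_lift_psubset: "Bolza_lift \<subset> Q_B1_cong (principal_OK sqrt2)"
proof
  show "Bolza_lift \<subseteq> Q_B1_cong (principal_OK sqrt2)"
  proof
    fix x assume "x \<in> Bolza_lift"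
    then obtain y where "y \<in> Q_B" "x - 1 = sqrt2 *\<^sub>K (\<pi> * y)" and "x \<in> Q_B" "nrd x = 1"
      by (auto simp: Bolza_lift_congruence congruence_subgroup_def carrier_Q_B1 prime_cubed_def)
    then show "x \<in> Q_B1_cong (principal_OK sqrt2)"
      unfolding mem_Q_B1_cong using Q_B_closed(2)[OF pi_Q_B] by blast
  qed
  have "\<gamma>\<^sup>2 \<in> Q_B1_cong (principal_OK sqrt2)"
  proof -
    have "\<gamma>\<^sup>2 - 1 = - (2 *\<^sub>K 1) - sqrt2 *\<^sub>K \<gamma>"
      unfolding gamma_powers two_D_B[symmetric] by (simp add: lin_def)
    then have "\<gamma>\<^sup>2 - 1 = sqrt2 *\<^sub>K (- (sqrt2 *\<^sub>K 1) - \<gamma>)"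
      by (simp add: D_B.scale_right_diff_distrib sqrt2_squared)
    moreover have "- (sqrt2 *\<^sub>K 1) - \<gamma> \<in> Q_B"
      by (intro Q_B_closed(4) uminus_Q_B scale_Q_B sqrt2_O_K one_Q_B gamma_Q_B)
    moreover have "\<gamma>\<^sup>2 \<in> carrier Q_B1" by simp
    ultimately show ?thesis unfolding mem_Q_B1_cong carrier_Q_B1 by blast
  qed
  moreover have "\<gamma>\<^sup>2 \<notin> Bolza_lift"
  proof
    assume "\<gamma>\<^sup>2 \<in> Bolza_lift"
    then have "\<alpha> ^ 0 * (\<gamma>\<^sup>2 * \<delta> ^ 0) = 1"
      using representative_trivial[of 0 2 0] by (simp add: Bolza_lift_congruence)
    then have "\<gamma>\<^sup>2 = 1" by simp
    then show False unfolding gamma_powers one_lin by (simp add: lin_inject)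
  qed
  ultimately show "Bolza_lift \<noteq> Q_B1_cong (principal_OK sqrt2)" by blast
qed

theorem theorem1p5:
  shows "proj ` Q_B1_cong (principal_OK 2) \<subset> Bolza_group
    \<and> Bolza_group \<subset> proj ` Q_B1_cong (principal_OK sqrt2)"
proof -
  have "signed_normal (Q_B1_cong (principal_OK 2))"
    by (rule signed_normal_principal[of 2 1]) (simp_all add: two_O_K one_O_K)
  moreover have "signed_normal (Q_B1_cong (principal_OK sqrt2))"
    by (rule signed_normal_principal[of sqrt2 sqrt2]) (simp_all add: sqrt2_O_K sqrt2_squared)
  ultimately show ?thesis
    unfolding Bolza_group_lift
    using proj_image_psubset signed_normal_Bolza_lift congruence_two_psubset Bolza_lift_psubset
    by simp
qed

end
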